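(* Let $\Gamma$ be a finite graph without loops and with at most one edge between any two vertices, and let $x\in\mathfrak{M}_\Gamma$ be a word such that the quiver $Q(\widetilde x)$ satisfies: (A) for every vertex $\alpha$ of $\Gamma$ the number of letters $s_\alpha$ and $s_{\bar\alpha}$ in $x$ is at least $3$; (B) for all vertices $\alpha,\beta$ of $\Gamma$ joined by an edge there exists at least one $\alpha\bar\beta$-cycle in $Q(\widetilde x)$. Then the space of primitive potentials on $Q(\widetilde x)$ modulo the action of right-equivalences preserving this space is isomorphic to the second cohomology group of the CW-complex $\mathcal{C}(\widetilde x)$ with coefficients in $\mathbf{k}^\times$.
   Context: $\mathbf{k}$ is a field of characteristic zero. Let $\Pi$ be the vertex set of $\Gamma$; put $C_{\alpha\alpha}=2$, $C_{\alpha\beta}=-1$ if $\alpha,\beta$ are joined by an edge, $C_{\alpha\beta}=0$ otherwise. $\mathfrak{M}_\Gamma$ is the free semigroup on letters $\{s_\alpha,s_{\bar\alpha}\mid\alpha\in\Pi\}$; its elements are called words. THE QUIVER $Q(\widetilde x)$. For a word $x$ let $n_\alpha$ be the number of letters $s_\alpha$ or $s_{\bar\alpha}$ in $x$; the $r$-th such letter from the left is denoted $s_\alpha^{(r)}$ (resp. $s_{\bar\alpha}^{(r)}$). The vertices of $Q(\widetilde x)$ are pairs $\binom{\alpha}{r}$ with $\alpha\in\Pi$, $r\in\mathbb{Z}/n_\alpha\mathbb{Z}$. Each letter contributes arrows and half-arrows (weight $\frac12$). The letter $s_\alpha^{(r)}$, with $\alpha'=\binom{\alpha}{r-1}$, $\alpha''=\binom{\alpha}{r}$,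 and, for each $\beta$ with $C_{\alpha\beta}=-1$, $\beta_*=\binom{\beta}{j}$ where $j$ is the number of letters $s_\beta,s_{\bar\beta}$ to the left of it, contributes one arrow $\alpha'\to\alpha''$ and half-arrows $\alpha''\to\beta_*$ and $\beta_*\to\alpha'$. A letter $s_{\bar\alpha}^{(r)}$ contributes the same with all directions reversed. The signed number of arrows from $v$ to $w$ is the sum of all contributions (opposite ones cancel). $\alpha\bar\beta$-CYCLES. Let $C_{\alpha\beta}=-1$. Choose a maximal subsequence of $x$ (read cyclically) consisting of letters $s_\alpha$ and $s_{\bar\beta}$ such that there are no letters $s_{\bar\alpha}$ and $s_\beta$ in between. It is composed of letters $s_\alpha^{(i+1)},\dots,s_\alpha^{(i+k)}$, $s_{\bar\beta}^{(j+1)},\dots,s_{\bar\beta}^{(j+l)}$ ($k$ or $l$ may be $0$; superscripts modulo $n_\alpha$, $n_\beta$) and defines the $\alpha\bar\beta$-cycle $$\binom{\beta}{j}\to\binom{\alpha}{i}\to\binom{\alpha}{i+1}\to\cdots\to\binom{\alpha}{i+k}\to\binom{\beta}{j+l}\to\binom{\beta}{j+l-1}\to\cdots\to\binom{\beta}{j}.$$ The source asserts that maximality makes this cycle well defined and that (A) makes all spaces of arrows one-dimensional; a basis of each arrow space is fixed. POTENTIALS. For a quiver $Q$, $R\langle\langle Q\rangle\rangle$ is the completed path algebra over $\mathbf{k}$ ($R$ the ring of $\mathbf{k}$-valued functions on vertices; completion along powers of the ideal generated by arrows). A potential is a (possibly infinite) linear combination of cyclic paths, considered up to cyclic shift. A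 right-equivalence is an $R$-algebra automorphism of $R\langle\langle Q\rangle\rangle$ that is the identity on $R$; it acts on potentials. A potential on $Q(\widetilde x)$ is primitive if it is a linear combination of all $\alpha\bar\beta$-cycles (over all $\alpha,\beta$ with $C_{\alpha\beta}=-1$), each with nonzero coefficient. COMPLEX. $\mathcal{C}(\widetilde x)$ is the 2-dimensional CW-complex with 1-skeleton $Q(\widetilde x)$ and one 2-cell attached along each $\alpha\bar\beta$-cycle, oriented so that the boundary of the cell of the cycle $a_1a_2\cdots a_k$ is $\sum_i a_i$. *)

theory Defs
  imports "HOL-Algebra.Algebra" "Graph_Theory.Arc_Walk"
begin

section \<open>Graphs and words\<close>

definition simple_graph :: "'a set \<Rightarrow> ('a \<times> 'a) set \<Rightarrow> bool" where
  "simple_graph V E \<longleftrightarrow> finite V \<and> E \<subseteq> V \<times> V \<and> sym E \<and> irrefl E"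

text \<open>\<open>Plain a\<close> is the letter \<open>s_a\<close> and \<open>Barred a\<close> is the letter \<open>s_{bar a}\<close>.\<close>

datatype 'a letter = Plain (vtx: 'a) | Barred (vtx: 'a)

definition free_semigroup :: "'a set \<Rightarrow> 'a letter list set" where
  "free_semigroup V = {x. x \<noteq> [] \<and> vtx ` set x \<subseteq> V}"

definition mult_in :: "'a letter list \<Rightarrow> 'a \<Rightarrow> nat" where
  "mult_in x a = length (filter (\<lambda>l. vtx l = a) x)"

text \<open>Words are read cyclically: \<open>cyc_nth x\<close> is the periodic extension of \<open>x\<close>, positions are
  counted from 0, and \<open>passed x a p\<close> is the number of letters \<open>s_a\<close>, \<open>s_{bar a}\<close> strictly to the
  left of position \<open>p\<close>.\<close>

definition cyc_nth :: "'a letter list \<Rightarrow> nat \<Rightarrow> 'a letter" where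
  "cyc_nth x p = x ! (p mod length x)"

definition passed :: "'a letter list \<Rightarrow> 'a \<Rightarrow> nat \<Rightarrow> nat" where
  "passed x a p = card {q. q < p \<and> vtx (cyc_nth x q) = a}"

section \<open>The quiver of a word\<close>

text \<open>The class of \<open>r\<close> in \<open>\<int>/n_a\<close> is represented by its remainder in \<open>{0..<n_a}\<close>.\<close>

definition node :: "'a letter list \<Rightarrow> 'a \<Rightarrow> nat \<Rightarrow> 'a \<times> nat" where
  "node x a r = (a, r mod mult_in x a)"

text \<open>The contribution of an arrow \<open>a \<rightarrow> b\<close> to the signed number of arrows from \<open>v\<close> to \<open>w\<close>.\<close>

definition unit_arrow :: "'v \<Rightarrow> 'v \<Rightarrow> 'v \<Rightarrow> 'v \<Rightarrow> rat" where
  "unit_arrow a b v w = of_bool (v = a \<and> w = b) - of_bool (v = b \<and> w = a)"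

definition letter_contribution ::
    "('a \<times> 'a) set \<Rightarrow> 'a letter list \<Rightarrow> nat \<Rightarrow> 'a \<times> nat \<Rightarrow> 'a \<times> nat \<Rightarrow> rat" where
  "letter_contribution E x p v w =
    (let a = vtx (x ! p);
         a' = node x a (passed x a p);
         a'' = node x a (passed x a p + 1);
         star = (\<lambda>b. node x b (passed x b p));
         direction = (case x ! p of Plain _ \<Rightarrow> 1 | Barred _ \<Rightarrow> -1)
     in direction * (unit_arrow a' a'' v w
          + (\<Sum>b | (a, b) \<in> E. 1/2 * unit_arrow a'' (star b) v w + 1/2 * unit_arrow (star b) a' v w)))"

definition signed_number ::
    "('a \<times> 'a) set \<Rightarrow> 'a letter list \<Rightarrow> 'a \<times> nat \<Rightarrow> 'a \<times> nat \<Rightarrow> rat" where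
  "signed_number E x v w = (\<Sum>p < length x. letter_contribution E x p v w)"

text \<open>\<open>(v, w, m)\<close> is the arrow number \<open>m\<close> (counted from 0) from \<open>v\<close> to \<open>w\<close>. The arrows \<open>(v, w, _)\<close>
  are the fixed basis of the space of arrows from \<open>v\<close> to \<open>w\<close>.\<close>

type_synonym 'a arrow = "('a \<times> nat) \<times> ('a \<times> nat) \<times> nat"

definition quiver ::
    "'a set \<Rightarrow> ('a \<times> 'a) set \<Rightarrow> 'a letter list \<Rightarrow> ('a \<times> nat, 'a arrow) pre_digraph" where
  "quiver V E x =
    (let N = {(a, r). a \<in> V \<and> r < mult_in x a}
     in \<lparr>verts = N,
         arcs = {(v, w, m). v \<in> N \<and> w \<in> N \<and> m < nat \<lfloor>signed_number E x v w\<rfloor>},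
         tail = (\<lambda>(v, w, m). v),
         head = (\<lambda>(v, w, m). w)\<rparr>)"

section \<open>The cycles defined by a word\<close>

text \<open>Maximal cyclic runs of letters \<open>s_a\<close>, \<open>s_{bar b}\<close> in the subword of letters over \<open>a\<close> and \<open>b\<close>,
  given by the two consecutive positions \<open>p < q\<close> of letters \<open>s_{bar a}\<close>, \<open>s_b\<close> which delimit them
  (\<open>q = p + length x\<close> if there is only one such letter). A word in which neither \<open>s_{bar a}\<close>
  nor \<open>s_b\<close> occurs has no such run: it has no well defined beginning there.\<close>

definition is_run :: "'a letter list \<Rightarrow> 'a \<Rightarrow> 'a \<Rightarrow> nat \<Rightarrow> nat \<Rightarrow> bool" where
  "is_run x a b p q \<longleftrightarrow> p < length x \<and> p < q
    \<and> cyc_nth x p \<in> {Barred a, Plain b} \<and> cyc_nth x q \<in> {Barred a, Plain b}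
    \<and> (\<forall>t. p < t \<and> t < q \<longrightarrow> cyc_nth x t \<notin> {Barred a, Plain b})
    \<and> (\<exists>t. p < t \<and> t < q \<and> cyc_nth x t \<in> {Plain a, Barred b})"

text \<open>The closed sequence of vertices
  \<open>(b,j) \<rightarrow> (a,i) \<rightarrow> (a,i+1) \<rightarrow> \<dots> \<rightarrow> (a,i+k) \<rightarrow> (b,j+l) \<rightarrow> (b,j+l-1) \<rightarrow> \<dots> \<rightarrow> (b,j)\<close>,
  without the final \<open>(b,j)\<close>.\<close>

definition run_nodes :: "'a letter list \<Rightarrow> 'a \<Rightarrow> 'a \<Rightarrow> nat \<Rightarrow> nat \<Rightarrow> ('a \<times> nat) list" where
  "run_nodes x a b p q =
    (let i = passed x a (p + 1); k = passed x a q - i;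
         j = passed x b (p + 1); l = passed x b q - j
     in node x b j # map (\<lambda>t. node x a (i + t)) [0..<Suc k] @ map (\<lambda>t. node x b (j + l - t)) [0..<l])"

definition closed_sequence :: "('a \<times> nat) list \<Rightarrow> 'a arrow list" where
  "closed_sequence vs = map (\<lambda>(v, w). (v, w, 0)) (zip vs (rotate1 vs))"

text \<open>A vertex sequence determines a path because all spaces of arrows are at most one-dimensional
  and all the arrows needed exist. There is one degenerate exception: the letters over \<open>a\<close>
  and \<open>b\<close> form, cyclically, a block over \<open>a\<close> followed by a block over \<open>b\<close>, and both places where
  the blocks meet separate runs. There the two arrows between the same two vertices either add up, and
  then the first basis arrow is used, or cancel, and then the sequence is not a cycle of the
  quiver and is disregarded.\<close>

definition ab_cycles ::
    "'a set \<Rightarrow> ('a \<times> 'a) set \<Rightarrow> 'a letter list \<Rightarrow> 'a \<Rightarrow> 'a \<Rightarrow> 'a arrow list set" where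
  "ab_cycles V E x a b =
    {closed_sequence (run_nodes x a b p q) | p q. is_run x a b p q
        \<and> set (closed_sequence (run_nodes x a b p q)) \<subseteq> arcs (quiver V E x)}"

definition all_cycles :: "'a set \<Rightarrow> ('a \<times> 'a) set \<Rightarrow> 'a letter list \<Rightarrow> 'a arrow list set" where
  "all_cycles V E x = (\<Union>(a, b) \<in> E. ab_cycles V E x a b)"

section \<open>Completed path algebras, potentials and right-equivalences\<close>

text \<open>A path is given by its initial vertex and its list of arrows, in the order in which they are
  traversed.\<close>

definition paths :: "('v, 'e) pre_digraph \<Rightarrow> ('v \<times> 'e list) set" where
  "paths Q = {(u, p). \<exists>v. pre_digraph.awalk Q u p v}"

text \<open>For a finite quiver, the completion of the path algebra along the powers of the arrow ideal
  consists of all formal, possibly infinite, linear combinations of paths, the product being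
  concatenation.\<close>

definition completed_path_algebra :: "('v, 'e) pre_digraph \<Rightarrow> ('v \<times> 'e list \<Rightarrow> 'k :: field) ring" where
  "completed_path_algebra Q =
    \<lparr>carrier = {f. \<forall>P. P \<notin> paths Q \<longrightarrow> f P = 0},
     monoid.mult = (\<lambda>f g (u, p). \<Sum>n \<le> length p.
               f (u, take n p) * g (last (pre_digraph.awalk_verts Q u (take n p)), drop n p)),
     one = (\<lambda>(u, p). of_bool (u \<in> verts Q \<and> p = [])),
     ring.zero = (\<lambda>_. 0),
     ring.add = (\<lambda>f g P. f P + g P)\<rparr>"

definition vertex_ring :: "('v, 'e) pre_digraph \<Rightarrow> ('v \<times> 'e list \<Rightarrow> 'k :: field) set" where
  "vertex_ring Q = {f \<in> carrier (completed_path_algebra Q). \<forall>u p. p \<noteq> [] \<longrightarrow> f (u, p) = 0}"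

text \<open>No continuity has to be required: the arrow ideal of a finite quiver is the Jacobson radical
  of the completed path algebra.\<close>

definition right_equivalences ::
    "('v, 'e) pre_digraph \<Rightarrow> (('v \<times> 'e list \<Rightarrow> 'k :: field) \<Rightarrow> ('v \<times> 'e list \<Rightarrow> 'k)) set" where
  "right_equivalences Q =
    {\<phi> \<in> ring_iso (completed_path_algebra Q) (completed_path_algebra Q). \<forall>f \<in> vertex_ring Q. \<phi> f = f}"

definition cyclic_paths :: "('v, 'e) pre_digraph \<Rightarrow> 'e list set" where
  "cyclic_paths Q = {p. p \<noteq> [] \<and> pre_digraph.awalk Q (tail Q (hd p)) p (tail Q (hd p))}"

definition cyclic_word :: "'e list \<Rightarrow> 'e list set" where
  "cyclic_word p = {rotate n p | n. True}"

text \<open>A potential is a family of coefficients indexed by the cyclic words of the quiver.\<close>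

type_synonym ('e, 'k) potential = "'e list set \<Rightarrow> 'k"

text \<open>The elements that are combinations of cyclic paths, and the potentials they represent.\<close>

definition cyclic_elements :: "('v, 'e) pre_digraph \<Rightarrow> ('v \<times> 'e list \<Rightarrow> 'k :: field) set" where
  "cyclic_elements Q = {f. \<forall>u p. f (u, p) \<noteq> 0 \<longrightarrow> p \<in> cyclic_paths Q \<and> u = tail Q (hd p)}"

definition potential_of ::
    "('v, 'e) pre_digraph \<Rightarrow> ('v \<times> 'e list \<Rightarrow> 'k :: field) \<Rightarrow> ('e, 'k) potential" where
  "potential_of Q f =
    (\<lambda>c. if c \<in> cyclic_word ` cyclic_paths Q then \<Sum>p \<in> c. f (tail Q (hd p), p) else 0)"

text \<open>The potential represented by \<open>\<phi> f\<close>, which is the same for all representatives \<open>f\<close> of \<open>W\<close>.\<close>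

definition act ::
    "('v, 'e) pre_digraph \<Rightarrow> (('v \<times> 'e list \<Rightarrow> 'k :: field) \<Rightarrow> ('v \<times> 'e list \<Rightarrow> 'k))
      \<Rightarrow> ('e, 'k) potential \<Rightarrow> ('e, 'k) potential" where
  "act Q \<phi> W = the_elem {potential_of Q (\<phi> f) | f. f \<in> cyclic_elements Q \<and> potential_of Q f = W}"

section \<open>Primitive potentials modulo right-equivalences\<close>

definition cycle_combination :: "'e list set \<Rightarrow> ('e list \<Rightarrow> 'k :: field) \<Rightarrow> ('e, 'k) potential" where
  "cycle_combination Z c = (\<lambda>w. \<Sum>p \<in> Z. c p * of_bool (w = cyclic_word p))"

definition primitive_potentials ::
    "'a set \<Rightarrow> ('a \<times> 'a) set \<Rightarrow> 'a letter list \<Rightarrow> ('a arrow, 'k :: field) potential set" where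
  "primitive_potentials V E x =
    {cycle_combination (all_cycles V E x) c | c. \<forall>p \<in> all_cycles V E x. c p \<noteq> 0}"

definition preserving_right_equivalences ::
    "'a set \<Rightarrow> ('a \<times> 'a) set \<Rightarrow> 'a letter list \<Rightarrow>
      ((('a \<times> nat) \<times> 'a arrow list \<Rightarrow> 'k :: field) \<Rightarrow> (('a \<times> nat) \<times> 'a arrow list \<Rightarrow> 'k)) set" where
  "preserving_right_equivalences V E x =
    {\<phi> \<in> right_equivalences (quiver V E x).
      act (quiver V E x) \<phi> ` primitive_potentials V E x = primitive_potentials V E x}"

definition orbit_relation ::
    "'a set \<Rightarrow> ('a \<times> 'a) set \<Rightarrow> 'a letter list \<Rightarrow>
      (('a arrow, 'k :: field) potential \<times> ('a arrow, 'k) potential) set" where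
  "orbit_relation V E x =
    {(W, W'). W \<in> primitive_potentials V E x \<and> W' \<in> primitive_potentials V E x
      \<and> (\<exists>\<phi> \<in> preserving_right_equivalences V E x. W' = act (quiver V E x) \<phi> W)}"

text \<open>The basis of the arrow spaces makes the space of primitive potentials a torus, with
  coefficientwise multiplication; the operation on orbits is the induced multiplication of
  subsets, as in a factor group.\<close>

definition primitive_torus ::
    "'a set \<Rightarrow> ('a \<times> 'a) set \<Rightarrow> 'a letter list \<Rightarrow> ('a arrow, 'k :: field) potential monoid" where
  "primitive_torus V E x =
    \<lparr>carrier = primitive_potentials V E x,
     monoid.mult = (\<lambda>W W' w. W w * W' w),
     one = cycle_combination (all_cycles V E x) (\<lambda>_. 1)\<rparr>"

definition primitive_moduli ::
    "'a set \<Rightarrow> ('a \<times> 'a) set \<Rightarrow> 'a letter list \<Rightarrow> ('a arrow, 'k :: field) potential set monoid" where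
  "primitive_moduli V E x =
    \<lparr>carrier = primitive_potentials V E x // orbit_relation V E x,
     monoid.mult = set_mult (primitive_torus V E x),
     one = orbit_relation V E x `` {\<one>\<^bsub>primitive_torus V E x\<^esub>}\<rparr>"

section \<open>Cellular cohomology\<close>

text \<open>The combinatorial data of a CW-complex with oriented cells: the cells of each dimension and
  their cellular boundaries.\<close>

record 'c cell_complex =
  cells :: "nat \<Rightarrow> 'c set"
  bdry :: "'c \<Rightarrow> 'c \<Rightarrow>\<^sub>0 int"

definition cochains :: "('c, 'm) cell_complex_scheme \<Rightarrow> 'b monoid \<Rightarrow> nat \<Rightarrow> ('c \<Rightarrow> 'b) monoid" where
  "cochains K A n = product_group (cells K n) (\<lambda>_. A)"

definition coboundary ::
    "('c, 'm) cell_complex_scheme \<Rightarrow> 'b monoid \<Rightarrow> nat \<Rightarrow> ('c \<Rightarrow> 'b) \<Rightarrow> ('c \<Rightarrow> 'b)" where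
  "coboundary K A n f =
    (\<lambda>s \<in> cells K (Suc n).
      \<Otimes>\<^bsub>A\<^esub>t \<in> Poly_Mapping.keys (bdry K s). f t [^]\<^bsub>A\<^esub> Poly_Mapping.lookup (bdry K s) t)"

definition cocycles :: "('c, 'm) cell_complex_scheme \<Rightarrow> 'b monoid \<Rightarrow> nat \<Rightarrow> ('c \<Rightarrow> 'b) set" where
  "cocycles K A n =
    {f \<in> carrier (cochains K A n). coboundary K A n f = \<one>\<^bsub>cochains K A (Suc n)\<^esub>}"

fun coboundaries :: "('c, 'm) cell_complex_scheme \<Rightarrow> 'b monoid \<Rightarrow> nat \<Rightarrow> ('c \<Rightarrow> 'b) set" where
  "coboundaries K A 0 = {\<one>\<^bsub>cochains K A 0\<^esub>}"
| "coboundaries K A (Suc n) = coboundary K A n ` carrier (cochains K A n)"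

definition cohomology_group ::
    "nat \<Rightarrow> ('c, 'm) cell_complex_scheme \<Rightarrow> 'b monoid \<Rightarrow> ('c \<Rightarrow> 'b) set monoid" where
  "cohomology_group n K A = ((cochains K A n)\<lparr>carrier := cocycles K A n\<rparr>) Mod coboundaries K A n"

definition multiplicative_group :: "'k :: field monoid" where
  "multiplicative_group = \<lparr>carrier = UNIV - {0}, monoid.mult = (*), one = 1\<rparr>"

section \<open>The CW-complex of a word\<close>

datatype 'a word_cell = Cell0 "'a \<times> nat" | Cell1 "'a arrow" | Cell2 "'a arrow list"

fun word_cell_boundary ::
    "('a \<times> nat, 'a arrow) pre_digraph \<Rightarrow> 'a word_cell \<Rightarrow> 'a word_cell \<Rightarrow>\<^sub>0 int" where
  "word_cell_boundary Q (Cell0 v) = 0"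
| "word_cell_boundary Q (Cell1 e) = frag_of (Cell0 (head Q e)) - frag_of (Cell0 (tail Q e))"
| "word_cell_boundary Q (Cell2 p) = (\<Sum>e \<leftarrow> p. frag_of (Cell1 e))"

definition word_complex ::
    "'a set \<Rightarrow> ('a \<times> 'a) set \<Rightarrow> 'a letter list \<Rightarrow> 'a word_cell cell_complex" where
  "word_complex V E x =
    \<lparr>cells = (\<lambda>n. if n = 0 then Cell0 ` verts (quiver V E x)
                else if n = 1 then Cell1 ` arcs (quiver V E x)
                else if n = 2 then Cell2 ` all_cycles V E x
                else {}),
     bdry = word_cell_boundary (quiver V E x)\<rparr>"

end

theory Submission
  imports Defs
begin

text \<open>A right-equivalence \<open>\<phi>\<close> sends an arrow \<open>e\<close> to a combination of arrows parallel to \<open>e\<close> plus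
  longer paths, so its effect on the coefficients of the cycles is linear and never transports a
  coefficient to a shorter cycle; between different cycles of equal length it transports nothing
  either, since no two arrows occurring in the cycles are parallel. A linear map from the torus of
  primitive potentials onto itself has to be monomial, because a linear form with two nonzero
  coefficients has a zero on the torus. Being triangular with respect to the length of cycles, it is
  then diagonal, and the factor at a cycle is the product of the diagonal linear coefficients of
  \<open>\<phi>\<close> at its arrows. Hence the orbits are those of the rescalings of arrows, and rescaling arrows is
  multiplication by a coboundary.\<close>

section \<open>Path algebras and right-equivalences\<close>

text \<open>Two obstacles shape the argument. A right-equivalence is merely a ring automorphism
  fixing the vertex ring, so neither linearity over the field nor compatibility with infinite sums
  is given. Linearity is recovered because scalars lie in the vertex ring. Control of lengths is
  recovered because the quiver has no loops, which denies the image of an arrow a constant term, and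
  because a first arrow can be split off a series in finitely many ways. Secondly, the coefficients
  of a primitive potential are coordinates only if different cycles define different cyclic words.
  The danger is that a cycle of the ordered pair \<open>a\<close>, \<open>b\<close> coincides with
  one of \<open>b\<close>, \<open>a\<close>. The former raises the index over \<open>a\<close> and
  lowers it over \<open>b\<close>, the latter does the opposite; they could share a step only where
  two steps lead back to the start, which three letters over each vertex forbid. Characteristic zero
  enters through 1 and 2 being distinct and nonzero, which is what moves a zero of a linear form
  into the torus. On the side of cohomology there are no 3-cells, so the torus is the whole group of
  2-cochains.\<close>

definition single :: "'b \<Rightarrow> 'b \<Rightarrow> 'k::field" where
  "single P = (\<lambda>R. of_bool (R = P))"

text \<open>For series this is membership in the \<open>n\<close>-th power of the arrow ideal, the
  filtration along which the path algebra is completed.\<close>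

definition order_ge :: "nat \<Rightarrow> ('a \<times> 'b list \<Rightarrow> 'k::field) \<Rightarrow> bool" where
  "order_ge n f \<longleftrightarrow> (\<forall>u p. length p < n \<longrightarrow> f (u, p) = 0)"

section \<open>Multiplication of formal series of paths\<close>

locale finite_quiver = fin_digraph Q + loopfree_digraph Q
  for Q :: "('v, 'e) pre_digraph" (structure)
begin

abbreviation pmult :: "('v \<times> 'e list \<Rightarrow> 'k::field) \<Rightarrow> ('v \<times> 'e list \<Rightarrow> 'k) \<Rightarrow> 'v \<times> 'e list \<Rightarrow> 'k"
    (infixl "\<star>" 70) where
  "f \<star> g \<equiv> f \<otimes>\<^bsub>completed_path_algebra Q\<^esub> g"

abbreviation series :: "('v \<times> 'e list \<Rightarrow> 'k::field) set" where
  "series \<equiv> carrier (completed_path_algebra Q)"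

lemma in_paths_iff: "(u, p) \<in> paths Q \<longleftrightarrow> awalk u p (awlast u p)"
  by (auto simp: paths_def)

lemma paths_Nil [simp]: "(u, []) \<in> paths Q \<longleftrightarrow> u \<in> verts Q"
  by (auto simp: in_paths_iff awalk_def)

lemma paths_Cons [simp]:
  "(u, e # p) \<in> paths Q \<longleftrightarrow> e \<in> arcs Q \<and> u = tail Q e \<and> (head Q e, p) \<in> paths Q"
  by (auto simp: in_paths_iff awalk_Cons_iff)

lemma paths_append [simp]:
  "(u, p @ q) \<in> paths Q \<longleftrightarrow> (u, p) \<in> paths Q \<and> (awlast u p, q) \<in> paths Q"
  by (simp add: in_paths_iff awlast_append)

lemma mem_series: "f \<in> series \<longleftrightarrow> (\<forall>P. P \<notin> paths Q \<longrightarrow> f P = 0)"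
  by (simp add: completed_path_algebra_def)

lemma series_nonpath: "f \<in> series \<Longrightarrow> P \<notin> paths Q \<Longrightarrow> f P = 0"
  unfolding mem_series by blast

lemma pmult_apply:
  "(f \<star> g) (u, p) = (\<Sum>n \<le> length p. f (u, take n p) * g (awlast u (take n p), drop n p))"
  by (simp add: completed_path_algebra_def)

lemma add_series: "f \<oplus>\<^bsub>completed_path_algebra Q\<^esub> g = (\<lambda>P. f P + g P)"
  by (simp add: completed_path_algebra_def)

lemma one_series: "\<one>\<^bsub>completed_path_algebra Q\<^esub> = (\<lambda>(u, p). of_bool (u \<in> verts Q \<and> p = []))"
  by (simp add: completed_path_algebra_def)

lemma pmult_closed: assumes "f \<in> series" "g \<in> series" shows "f \<star> g \<in> series"
  unfolding mem_series
proof (intro allI impI)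
  fix P assume P: "P \<notin> paths Q"
  obtain u p where [simp]: "P = (u, p)" by (cases P)
  have "f (u, take n p) * g (awlast u (take n p), drop n p) = 0" for n
  proof -
    have "\<not> ((u, take n p) \<in> paths Q \<and> (awlast u (take n p), drop n p) \<in> paths Q)"
      using P by (metis \<open>P = (u, p)\<close> append_take_drop_id paths_append)
    then show ?thesis using assms by (auto simp: mem_series)
  qed
  then show "(f \<star> g) P = 0" by (simp add: pmult_apply del: mult_eq_0_iff)
qed

lemma single_series: "P \<in> paths Q \<Longrightarrow> single P \<in> series"
  by (auto simp: mem_series single_def)

lemma single_vertex: "u \<in> verts Q \<Longrightarrow> single (u, []) \<in> vertex_ring Q"
  by (auto simp: vertex_ring_def single_series) (simp add: single_def)

text \<open>Among all cuts of a path \<open>s\<close>, only the one after \<open>length p\<close>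
  arrows can match both factors.\<close>

lemma single_pmult_single:
  assumes v: "v = awlast u p"
  shows "single (u, p) \<star> single (v, q) = (single (u, p @ q) :: _ \<Rightarrow> 'x::field)"
proof (rule ext, clarify)
  fix w s
  have *: "single (u, p) (w, take n s) * single (v, q) (awlast w (take n s), drop n s)
      = (of_bool (n = length p \<and> w = u \<and> s = p @ q) :: 'x)" if "n \<le> length s" for n
    using that v by (auto simp: single_def)
  have "(single (u, p) \<star> single (v, q) :: _ \<Rightarrow> 'x) (w, s)
      = (\<Sum>n \<le> length s. of_bool (n = length p \<and> w = u \<and> s = p @ q))"
    unfolding pmult_apply by (intro sum.cong refl *) simp
  also have "\<dots> = (\<Sum>n \<le> length s. if n = length p then of_bool (w = u \<and> s = p @ q) else 0)"
    by (intro sum.cong) auto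
  also have "\<dots> = single (u, p @ q) (w, s)"
    by (auto simp: single_def)
  finally show "(single (u, p) \<star> single (v, q)) (w, s) = (single (u, p @ q) :: _ \<Rightarrow> 'x) (w, s)" .
qed

lemma vertex_pmult: "(single (u, []) \<star> f) (v, p) = of_bool (v = u) * f (v, p)"
proof -
  have "(single (u, []) \<star> f) (v, p) = (\<Sum>n \<le> length p. if n = 0 then of_bool (v = u) * f (v, p) else 0)"
    unfolding pmult_apply by (intro sum.cong) (auto simp: single_def)
  then show ?thesis by simp
qed

lemma pmult_vertex: "(f \<star> single (u, [])) (v, p) = f (v, p) * of_bool (awlast v p = u)"
proof -
  have "(f \<star> single (u, [])) (v, p)
      = (\<Sum>n \<le> length p. if n = length p then f (v, p) * of_bool (awlast v p = u) else 0)"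
    unfolding pmult_apply by (intro sum.cong) (auto simp: single_def)
  then show ?thesis by simp
qed

lemma arc_pmult_Cons:
  "(single (tail Q e, [e]) \<star> f) (u, e' # p) = of_bool (u = tail Q e \<and> e' = e) * f (head Q e, p)"
proof -
  have "(single (tail Q e, [e]) \<star> f) (u, e' # p)
      = (\<Sum>n \<le> Suc (length p). if n = 1 then of_bool (u = tail Q e \<and> e' = e) * f (head Q e, p) else 0)"
    unfolding pmult_apply
  proof (intro sum.cong)
    fix n assume "n \<in> {..Suc (length p)}"
    then consider "n = 0" | "n = 1" | m where "n = Suc (Suc m)" "p \<noteq> []"
      by (cases n; cases "n - 1"; cases p) auto
    then show "single (tail Q e, [e]) (u, take n (e' # p)) * f (awlast u (take n (e' # p)), drop n (e' # p))
        = (if n = 1 then of_bool (u = tail Q e \<and> e' = e) * f (head Q e, p) else 0)"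
      by cases (auto simp: single_def)
  qed simp
  also have "\<dots> = of_bool (u = tail Q e \<and> e' = e) * f (head Q e, p)"
    by (subst sum.delta) auto
  finally show ?thesis .
qed

lemma arc_pmult_Nil: "(single (tail Q e, [e]) \<star> f) (u, []) = 0"
  by (simp add: pmult_apply single_def)

text \<open>The cofactor of \<open>e\<close> when a series is expanded by first arrows. Restricting
  the start to the head of \<open>e\<close> keeps the support among paths.\<close>

definition left_quotient :: "'e \<Rightarrow> ('v \<times> 'e list \<Rightarrow> 'k::field) \<Rightarrow> 'v \<times> 'e list \<Rightarrow> 'k" where
  "left_quotient e f = (\<lambda>(v, p). of_bool (v = head Q e) * f (tail Q e, e # p))"

lemma left_quotient_series: "f \<in> series \<Longrightarrow> left_quotient e f \<in> series"
  by (auto simp: mem_series left_quotient_def)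

text \<open>Grouping paths by their first arrow turns an infinite series into a finite sum of
  products, to which a ring homomorphism can be applied.\<close>

lemma arc_expansion:
  assumes "f \<in> series" "\<And>u. f (u, []) = 0"
  shows "f = (\<lambda>P. \<Sum>e \<in> arcs Q. (single (tail Q e, [e]) \<star> left_quotient e f) P)"
proof (rule ext, clarify)
  fix u p
  show "f (u, p) = (\<Sum>e \<in> arcs Q. (single (tail Q e, [e]) \<star> left_quotient e f) (u, p))"
  proof (cases p)
    case Nil
    then show ?thesis using assms by (simp add: arc_pmult_Nil)
  next
    case (Cons e' p')
    have "(\<Sum>e \<in> arcs Q. (single (tail Q e, [e]) \<star> left_quotient e f) (u, p))
        = (\<Sum>e \<in> arcs Q. if e = e' then of_bool (u = tail Q e') * f (tail Q e', e' # p') else 0)"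
      by (intro sum.cong) (auto simp: Cons arc_pmult_Cons left_quotient_def)
    also have "\<dots> = f (u, p)"
      using series_nonpath[OF assms(1), of "(u, p)"] by (auto simp: Cons)
    finally show ?thesis by simp
  qed
qed

lemma order_ge_pmult:
  fixes f g :: "'v \<times> 'e list \<Rightarrow> 'k::field"
  assumes "order_ge m f" "order_ge n g" shows "order_ge (m + n) (f \<star> g)"
  unfolding order_ge_def
proof (intro allI impI)
  fix u p assume *: "length (p :: 'e list) < m + n"
  have "f (u, take i p) * g (awlast u (take i p), drop i p) = 0" if "i \<le> length p" for i
    using assms * that by (cases "i < m") (auto simp: order_ge_def)
  then show "(f \<star> g) (u, p) = 0" unfolding pmult_apply by (intro sum.neutral) auto
qed

end

section \<open>Lengths and leading terms under a right-equivalence\<close>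

locale right_equivalence = finite_quiver Q for Q :: "('v, 'e) pre_digraph" (structure) +
  fixes \<phi> :: "('v \<times> 'e list \<Rightarrow> 'k::field) \<Rightarrow> ('v \<times> 'e list \<Rightarrow> 'k)"
  assumes right_equivalence: "\<phi> \<in> right_equivalences Q"
begin

lemma closed: "f \<in> series \<Longrightarrow> \<phi> f \<in> series"
  using right_equivalence
  by (auto simp: right_equivalences_def ring_iso_def ring_hom_def)

lemma mult: "f \<in> series \<Longrightarrow> g \<in> series \<Longrightarrow> \<phi> (f \<star> g) = \<phi> f \<star> \<phi> g"
  using right_equivalence by (simp add: right_equivalences_def ring_iso_def ring_hom_def)

lemma add: "f \<in> series \<Longrightarrow> g \<in> series \<Longrightarrow> \<phi> (\<lambda>P. f P + g P) = (\<lambda>P. \<phi> f P + \<phi> g P)"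
  using right_equivalence
  by (simp add: right_equivalences_def ring_iso_def ring_hom_def flip: add_series)

lemma vertex: "f \<in> vertex_ring Q \<Longrightarrow> \<phi> f = f"
  using right_equivalence by (simp add: right_equivalences_def)

lemma zero: "\<phi> (\<lambda>_. 0) = (\<lambda>_. 0)"
  by (intro vertex) (simp add: vertex_ring_def mem_series)

text \<open>A ring homomorphism need not be linear, but multiplication by \<open>c\<close> is the
  product with \<open>c\<close> times the sum of all vertices, an element that is fixed.\<close>

lemma scale:
  assumes f: "f \<in> series" shows "\<phi> (\<lambda>P. c * f P) = (\<lambda>P. c * \<phi> f P)"
proof -
  define s :: "'v \<times> 'e list \<Rightarrow> 'k" where "s = (\<lambda>(u, p). c * of_bool (u \<in> verts Q \<and> p = []))"
  have s: "s \<in> vertex_ring Q"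
    by (auto simp: s_def vertex_ring_def mem_series)
  have *: "s \<star> g = (\<lambda>P. c * g P)" if g: "g \<in> series" for g
  proof (rule ext, clarify)
    fix u p
    have "(s \<star> g) (u, p) = (\<Sum>n \<le> length p. if n = 0 then c * of_bool (u \<in> verts Q) * g (u, p) else 0)"
      unfolding pmult_apply by (intro sum.cong) (auto simp: s_def)
    also have "\<dots> = c * g (u, p)"
      using series_nonpath[OF g, of "(u, p)"] by (auto simp: in_paths_iff awalk_def)
    finally show "(s \<star> g) (u, p) = c * g (u, p)" .
  qed
  have "\<phi> (s \<star> f) = s \<star> \<phi> f"
    using mult[of s f] f s by (simp add: vertex vertex_ring_def)
  then show ?thesis using *[OF f] *[OF closed[OF f]] by simp
qed

lemma sum:
  assumes "finite I" "\<And>i. i \<in> I \<Longrightarrow> f i \<in> series"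
  shows "\<phi> (\<lambda>P. \<Sum>i\<in>I. c i * f i P) = (\<lambda>P. \<Sum>i\<in>I. c i * \<phi> (f i) P)"
  using assms
proof (induction I rule: finite_induct)
  case empty
  then show ?case by (simp add: zero)
next
  case (insert i I)
  have "(\<lambda>P. c i * f i P) \<in> series" "(\<lambda>P. \<Sum>i\<in>I. c i * f i P) \<in> series"
    using insert.prems by (auto simp: mem_series)
  from add[OF this] show ?case using insert scale[of "f i" "c i"] by simp
qed

text \<open>An arrow equals itself multiplied by its tail on the left and its head on the right.
  Both vertices are fixed, so the image is framed by them too.\<close>

lemma arc_image_support:
  assumes e: "e \<in> arcs Q" and nz: "\<phi> (single (tail Q e, [e])) (v, p) \<noteq> 0"
  shows "v = tail Q e" "awlast v p = head Q e"
proof -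
  let ?s = "single (tail Q e, [e]) :: _ \<Rightarrow> 'k"
  let ?t = "single (tail Q e, []) :: _ \<Rightarrow> 'k"
  let ?h = "single (head Q e, []) :: _ \<Rightarrow> 'k"
  have s: "?s \<in> series" "?t \<in> series" "?h \<in> series"
    using e by (auto intro!: single_series)
  have "?s = (?t \<star> ?s) \<star> ?h"
    using e by (simp add: single_pmult_single)
  then have "\<phi> ?s = (\<phi> ?t \<star> \<phi> ?s) \<star> \<phi> ?h"
    using s by (metis mult pmult_closed)
  also have "\<dots> = (?t \<star> \<phi> ?s) \<star> ?h"
    using e by (simp add: vertex single_vertex)
  finally have "\<phi> ?s (v, p) = of_bool (v = tail Q e) * \<phi> ?s (v, p) * of_bool (awlast v p = head Q e)"
    by (metis pmult_vertex vertex_pmult)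
  with nz show "v = tail Q e" "awlast v p = head Q e" by (auto simp: of_bool_def split: if_splits)
qed

text \<open>A constant term at a vertex would force this vertex to be both tail and head, hence a
  loop.\<close>

lemma order_ge_arc_image: "e \<in> arcs Q \<Longrightarrow> order_ge 1 (\<phi> (single (tail Q e, [e])))"
  using arc_image_support[of e _ "[]"] no_loops[of e] by (auto simp: order_ge_def)

text \<open>An element of order at least \<open>n + 1\<close> is a finite sum of products of an arrow with an element of
  order at least \<open>n\<close>, so no continuity of \<open>\<phi>\<close> is needed.\<close>

lemma order_ge_image:
  assumes "f \<in> series" "order_ge n f" shows "order_ge n (\<phi> f)"
  using assms
proof (induction n arbitrary: f)
  case 0
  then show ?case by (simp add: order_ge_def)
next
  case (Suc n)
  have q: "left_quotient e f \<in> series" for e using Suc.prems by (simp add: left_quotient_series)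
  have s: "(single (tail Q e, [e]) :: _ \<Rightarrow> 'k) \<in> series" if "e \<in> arcs Q" for e
    using that by (simp add: single_series)
  \<comment> \<open>The coefficient \<open>1\<close> gives the expansion the form of a linear
    combination, as in \<open>sum\<close>.\<close>
  have "f = (\<lambda>P. \<Sum>e \<in> arcs Q. 1 * (single (tail Q e, [e]) \<star> left_quotient e f) P)"
    using arc_expansion[of f] Suc.prems by (simp add: order_ge_def)
  then have "\<phi> f = \<phi> (\<lambda>P. \<Sum>e \<in> arcs Q. 1 * (single (tail Q e, [e]) \<star> left_quotient e f) P)"
    by simp
  also have "\<dots> = (\<lambda>P. \<Sum>e \<in> arcs Q. 1 * \<phi> (single (tail Q e, [e]) \<star> left_quotient e f) P)"
    using q s by (intro sum) (auto intro: pmult_closed)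
  also have "\<dots> = (\<lambda>P. \<Sum>e \<in> arcs Q. (\<phi> (single (tail Q e, [e])) \<star> \<phi> (left_quotient e f)) P)"
    using q s by (intro ext sum.cong) (auto simp: mult)
  finally have "\<phi> f = \<dots>" .
  moreover have "order_ge (1 + n) (\<phi> (single (tail Q e, [e])) \<star> \<phi> (left_quotient e f))"
    if "e \<in> arcs Q" for e
    using that Suc.prems by (intro order_ge_pmult order_ge_arc_image Suc.IH q)
      (auto simp: order_ge_def left_quotient_def)
  ultimately show ?case by (simp add: order_ge_def)
qed

lemma order_ge_path_image: "(u, p) \<in> paths Q \<Longrightarrow> order_ge (length p) (\<phi> (single (u, p)))"
  by (intro order_ge_image single_series) (auto simp: order_ge_def single_def)

text \<open>The first factor has no constant term and the second starts at length
  \<open>length p\<close>, so in a path of the original length only the cut after one arrow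
  contributes.\<close>

lemma path_image_Cons:
  assumes p: "(u, e # p) \<in> paths Q" and q: "length q = length p"
  shows "\<phi> (single (u, e # p)) (w, e' # q)
    = \<phi> (single (u, [e])) (w, [e']) * \<phi> (single (head Q e, p)) (head Q e', q)"
proof -
  let ?s = "single (u, [e]) :: _ \<Rightarrow> 'k" and ?t = "single (head Q e, p) :: _ \<Rightarrow> 'k"
  let ?f = "\<phi> ?s" and ?g = "\<phi> ?t"
  have eq: "\<phi> (single (u, e # p)) = ?f \<star> ?g"
  proof -
    have "single (u, e # p) = ?s \<star> ?t" by (simp add: single_pmult_single)
    moreover have "?s \<in> series" "?t \<in> series" using p by (auto intro: single_series)
    ultimately show ?thesis by (simp add: mult)
  qed
  have f: "order_ge 1 ?f" and g: "order_ge (length p) ?g"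
    using p order_ge_arc_image order_ge_path_image by auto
  have "(?f \<star> ?g) (w, e' # q) = (\<Sum>n \<le> Suc (length q). if n = 1 then ?f (w, [e']) * ?g (head Q e', q) else 0)"
    unfolding pmult_apply
  proof (intro sum.cong, simp)
    fix n assume n: "n \<in> {..Suc (length q)}"
    consider "n = 0" | "n = 1" | "n > 1" by linarith
    then show "?f (w, take n (e' # q)) * ?g (awlast w (take n (e' # q)), drop n (e' # q))
        = (if n = 1 then ?f (w, [e']) * ?g (head Q e', q) else 0)"
    proof cases
      case 1
      then show ?thesis using f by (simp add: order_ge_def)
    next
      case 2
      then show ?thesis by simp
    next
      case 3
      then have "length (drop n (e' # q)) < length p" using q n by simp
      then show ?thesis using g 3 by (auto simp: order_ge_def)
    qed
  qed
  also have "\<dots> = ?f (w, [e']) * ?g (head Q e', q)"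
    by (subst sum.delta) auto
  finally show ?thesis by (simp add: eq)
qed

text \<open>By \<open>path_image_Cons\<close> the terms of unchanged length come from the linear
  parts of the arrow images, and these involve only parallel arrows.\<close>

lemma path_image_parallel:
  assumes "(u, p) \<in> paths Q" "length q = length p" "\<phi> (single (u, p)) (w, q) \<noteq> 0"
  shows "list_all2 (\<lambda>e e'. tail Q e = tail Q e' \<and> head Q e = head Q e') p q"
  using assms
proof (induction p arbitrary: u q w)
  case Nil
  then show ?case by simp
next
  case (Cons e p)
  then obtain e' q' where q: "q = e' # q'" "length q' = length p" by (cases q) auto
  have nz: "\<phi> (single (u, [e])) (w, [e']) \<noteq> 0" "\<phi> (single (head Q e, p)) (head Q e', q') \<noteq> 0"
    using Cons.prems q path_image_Cons[of u e p q' w e'] by auto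
  have e: "e \<in> arcs Q" "u = tail Q e" "(head Q e, p) \<in> paths Q" using Cons.prems by auto
  have "\<phi> (single (u, [e])) \<in> series"
    using e by (intro closed single_series) simp
  from series_nonpath[OF this] have "(w, [e']) \<in> paths Q" using nz(1) by blast
  moreover from this have "w = tail Q e" "head Q e' = head Q e"
    using nz(1) arc_image_support[of e w "[e']"] e by auto
  ultimately show ?case using Cons.IH[OF e(3) q(2) nz(2)] q by simp
qed

lemma path_image_diagonal:
  assumes "(u, p) \<in> paths Q"
  shows "\<phi> (single (u, p)) (u, p) = (\<Prod>e\<leftarrow>p. \<phi> (single (tail Q e, [e])) (tail Q e, [e]))"
  using assms
proof (induction p arbitrary: u)
  case Nil
  then show ?case by (simp add: vertex single_vertex) (simp add: single_def)
next
  case (Cons e p)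
  then show ?case using path_image_Cons[OF Cons.prems refl, of u e] by auto
qed

end

section \<open>Potentials\<close>

lemma self_in_cyclic_word: "p \<in> cyclic_word p"
  unfolding cyclic_word_def by (metis (mono_tags) mem_Collect_eq rotate0 id_apply)

lemma finite_cyclic_word: "finite (cyclic_word p)"
proof (cases "p = []")
  case False
  have "cyclic_word p \<subseteq> (\<lambda>n. rotate n p) ` {..<length p}"
  proof
    fix q assume "q \<in> cyclic_word p"
    then obtain n where "q = rotate (n mod length p) p"
      by (auto simp: cyclic_word_def) (metis rotate_conv_mod)
    then show "q \<in> (\<lambda>n. rotate n p) ` {..<length p}" using False by auto
  qed
  then show ?thesis using finite_surj by blast
qed (simp add: cyclic_word_def)

lemma in_cyclic_wordD:
  assumes "q \<in> cyclic_word p"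
  obtains n where "n \<le> length p" "q = rotate n p" "q = drop n p @ take n p"
proof -
  obtain m where "q = rotate m p" using assms by (auto simp: cyclic_word_def)
  then show ?thesis
    using that[of 0] that[of "m mod length p"]
    by (cases "p = []") (auto simp: rotate_drop_take less_imp_le)
qed

lemma length_in_cyclic_word: "q \<in> cyclic_word p \<Longrightarrow> length q = length p"
  by (auto simp: cyclic_word_def)

lemma rotate_in_cyclic_word: "q \<in> cyclic_word p \<Longrightarrow> rotate n q \<in> cyclic_word p"
  by (auto simp: cyclic_word_def rotate_rotate)

lemma cyclic_word_eq: assumes "q \<in> cyclic_word p" shows "cyclic_word q = cyclic_word p"
proof -
  have *: "cyclic_word s \<subseteq> cyclic_word r" if "s \<in> cyclic_word r" for s r :: "'a list"
    using rotate_in_cyclic_word[OF that] by (auto simp: cyclic_word_def)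
  obtain n where "n \<le> length p" "q = rotate n p" using assms by (rule in_cyclic_wordD)
  then have "rotate (length p - n) q = p" by (simp add: rotate_rotate)
  then have "p \<in> cyclic_word q" unfolding cyclic_word_def by (metis (mono_tags) mem_Collect_eq)
  then show ?thesis using * assms by blast
qed

lemma potential_of_sum:
  "potential_of Q (\<lambda>P. \<Sum>i\<in>I. c i * f i P) = (\<lambda>w. \<Sum>i\<in>I. c i * potential_of Q (f i) w)"
proof
  fix w
  show "potential_of Q (\<lambda>P. \<Sum>i\<in>I. c i * f i P) w = (\<Sum>i\<in>I. c i * potential_of Q (f i) w)"
    by (simp add: potential_of_def sum_distrib_left) (simp add: sum.swap[of _ I])
qed

lemma potential_of_add:
  "potential_of Q (\<lambda>P. f P + g P) = (\<lambda>w. potential_of Q f w + potential_of Q g w)"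
  by (auto simp: potential_of_def sum.distrib)

context finite_quiver
begin

abbreviation cycle_path :: "'e list \<Rightarrow> 'v \<times> 'e list" where
  "cycle_path p \<equiv> (tail Q (hd p), p)"

text \<open>Cutting a closed path and exchanging the pieces moves its base point to the cut. The cut
  at \<open>n = length p\<close>, with an empty second piece, is included.\<close>

lemma cyclic_path_split:
  assumes p: "p \<in> cyclic_paths Q" and n: "n \<le> length p"
  defines "u \<equiv> tail Q (hd p)" and "v \<equiv> awlast (tail Q (hd p)) (take n p)"
  shows "awalk u (take n p) v" "awalk v (drop n p) u" "drop n p @ take n p \<in> cyclic_paths Q"
    "tail Q (hd (drop n p @ take n p)) = v"
proof -
  have "awalk u (take n p @ drop n p) u" using p by (simp add: cyclic_paths_def u_def)
  then show 1: "awalk u (take n p) v" and 2: "awalk v (drop n p) u"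
    unfolding awalk_append_iff v_def u_def by auto
  have ne: "drop n p @ take n p \<noteq> []"
    using p n by (cases "n = 0") (auto simp: cyclic_paths_def)
  have w: "awalk v (drop n p @ take n p) v" using awalk_appendI[OF 2 1] .
  then show v: "tail Q (hd (drop n p @ take n p)) = v"
    using ne by (cases "drop n p @ take n p") (auto simp: awalk_Cons_iff)
  show "drop n p @ take n p \<in> cyclic_paths Q"
    using ne w v unfolding cyclic_paths_def by blast
qed

lemma cyclic_word_subset: "p \<in> cyclic_paths Q \<Longrightarrow> q \<in> cyclic_word p \<Longrightarrow> q \<in> cyclic_paths Q"
  by (metis cyclic_path_split(3) in_cyclic_wordD)

lemma cycle_path_in_paths: "p \<in> cyclic_paths Q \<Longrightarrow> cycle_path p \<in> paths Q"
  by (auto simp: cyclic_paths_def paths_def)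

text \<open>The trace property: commutators represent the zero potential. Terms that are not closed
  paths do not enter \<open>potential_of\<close>, so it holds for arbitrary factors.\<close>

lemma potential_of_pmult_commute: "potential_of Q (f \<star> g) = potential_of Q (g \<star> f)"
proof
  fix w
  show "potential_of Q (f \<star> g) w = potential_of Q (g \<star> f) w"
  proof (cases "w \<in> cyclic_word ` cyclic_paths Q")
    case True
    then obtain c where c: "c \<in> cyclic_paths Q" "w = cyclic_word c" by blast
    define m where "m = length c"
    let ?t = "\<lambda>f g p n. f (tail Q (hd p), take n p) * g (awlast (tail Q (hd p)) (take n p), drop n p)"
    have len: "length p = m" if "p \<in> w" for p using that c length_in_cyclic_word m_def by blast
    have sum: "potential_of Q (f \<star> g) w = (\<Sum>(p, n) \<in> w \<times> {..m}. ?t f g p n)" for f g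
    proof -
      have "potential_of Q (f \<star> g) w = (\<Sum>p\<in>w. \<Sum>n\<le>m. ?t f g p n)"
        using True len by (auto simp: potential_of_def pmult_apply intro!: sum.cong)
      then show ?thesis by (simp add: sum.cartesian_product)
    qed
    \<comment> \<open>A pair \<open>(p, n)\<close> is a closed path cut after \<open>n\<close>
      arrows. Exchanging the pieces is an involution, and it pairs the cut at \<open>0\<close> with
      the cut at \<open>m\<close>, so both ends must be in the range.\<close>
    let ?r = "\<lambda>(p, n). (drop n p @ take n p, m - n)"
    have "?r x \<in> w \<times> {..m} \<and> ?r (?r x) = x
        \<and> (case ?r x of (p, n) \<Rightarrow> ?t g f p n) = (case x of (p, n) \<Rightarrow> ?t f g p n)"
      if "x \<in> w \<times> {..m}" for x
    proof -
      obtain p n where x: "x = (p, n)" "p \<in> w" "n \<le> m" using \<open>x \<in> w \<times> {..m}\<close> by auto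
      note l = len[OF x(2)]
      have "p \<in> cyclic_paths Q" using x c cyclic_word_subset by blast
      note s = cyclic_path_split[OF this, of n, unfolded l, OF x(3)]
      have "drop n p @ take n p = rotate n p"
        using l x(3) by (cases "n = m") (auto simp: rotate_drop_take)
      then have "drop n p @ take n p \<in> w" using x c rotate_in_cyclic_word by metis
      moreover have "awlast (awlast (tail Q (hd p)) (take n p)) (drop n p) = tail Q (hd p)"
        using s(2) by auto
      ultimately show ?thesis using x l s(4) by simp
    qed
    then show ?thesis unfolding sum
      by (intro sum.reindex_bij_witness[of _ ?r ?r]) blast+
  qed (simp add: potential_of_def)
qed

lemma cyclic_elements_subset: "f \<in> cyclic_elements Q \<Longrightarrow> f \<in> series"
  unfolding mem_series cyclic_elements_def using cycle_path_in_paths by force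

lemma potential_of_order_ge:
  "order_ge n f \<Longrightarrow> length p < n \<Longrightarrow> potential_of Q f (cyclic_word p) = 0"
  by (auto simp: potential_of_def order_ge_def length_in_cyclic_word intro!: sum.neutral)

text \<open>A cyclic word is a set, so \<open>p\<close> is counted once in it even if
  \<open>p\<close> is a proper power and several rotations coincide.\<close>

lemma potential_of_single:
  assumes "p \<in> cyclic_paths Q"
  shows "potential_of Q (single (cycle_path p)) = (\<lambda>w. of_bool (w = cyclic_word p) :: 'x::field)"
proof
  fix w
  have "(\<Sum>q\<in>cyclic_word c. single (cycle_path p) (cycle_path q))
      = (of_bool (cyclic_word c = cyclic_word p) :: 'x)" for c
  proof -
    have "(\<Sum>q\<in>cyclic_word c. single (cycle_path p) (cycle_path q) :: 'x)
        = (\<Sum>q\<in>cyclic_word c. if q = p then 1 else 0)"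
      by (intro sum.cong) (auto simp: single_def)
    also have "\<dots> = of_bool (cyclic_word c = cyclic_word p)"
      using cyclic_word_eq[of p c] self_in_cyclic_word[of p] by (auto simp: finite_cyclic_word)
    finally show ?thesis by blast
  qed
  then show "potential_of Q (single (cycle_path p)) w = (of_bool (w = cyclic_word p) :: 'x)"
    using assms by (auto simp: potential_of_def)
qed

end

section \<open>The action on potentials is well defined\<close>

context right_equivalence
begin

text \<open>If \<open>p\<close> is the product of two pieces, its rotation is the product in the
  other order; the trace property survives \<open>\<phi>\<close> because \<open>\<phi>\<close> is
  multiplicative.\<close>

lemma potential_of_rotated:
  assumes "p \<in> cyclic_paths Q" "q \<in> cyclic_word p"
  shows "potential_of Q (\<phi> (single (cycle_path q))) = potential_of Q (\<phi> (single (cycle_path p)))"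
proof -
  obtain n where n: "n \<le> length p" "q = drop n p @ take n p" using assms(2) in_cyclic_wordD by metis
  note s = cyclic_path_split[OF assms(1) n(1)]
  let ?u = "tail Q (hd p)" and ?v = "tail Q (hd q)"
  let ?f = "single (?u, take n p) :: _ \<Rightarrow> 'k" and ?g = "single (?v, drop n p) :: _ \<Rightarrow> 'k"
  have fg: "?f \<in> series" "?g \<in> series"
    using s n(2) by (auto simp: in_paths_iff intro!: single_series)
  have "(single (cycle_path p) :: _ \<Rightarrow> 'k) = ?f \<star> ?g"
    using s n(2) by (subst single_pmult_single) auto
  moreover have "(single (cycle_path q) :: _ \<Rightarrow> 'k) = ?g \<star> ?f"
    using s n(2) by (subst single_pmult_single) auto
  ultimately show ?thesis using fg by (simp add: mult potential_of_pmult_commute)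
qed

text \<open>The coefficient at a cyclic word only depends on the finitely many terms of \<open>f\<close> that are not
  longer than this word.\<close>

lemma potential_of_image_eq_0:
  assumes f: "f \<in> cyclic_elements Q" and f0: "potential_of Q f = (\<lambda>_. 0)"
  shows "potential_of Q (\<phi> f) = (\<lambda>_. 0)"
proof
  fix w
  show "potential_of Q (\<phi> f) w = 0"
  proof (cases "w \<in> cyclic_word ` cyclic_paths Q")
    case True
    then obtain c where c: "c \<in> cyclic_paths Q" "w = cyclic_word c" by blast
    define S where "S = {p \<in> cyclic_paths Q. length p \<le> length c}"
    have "S \<subseteq> {p. set p \<subseteq> arcs Q \<and> length p \<le> length c}"
      by (auto simp: S_def cyclic_paths_def awalk_def)
    then have S: "finite S" using finite_lists_length_le[OF finite_arcs] finite_subset by blast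
    have series: "(single (cycle_path p) :: _ \<Rightarrow> 'k) \<in> series" if "p \<in> S" for p
      using that cycle_path_in_paths by (auto simp: S_def intro: single_series)
    define g where "g = (\<lambda>P. \<Sum>p\<in>S. f (cycle_path p) * single (cycle_path p) P)"
    define h where "h = (\<lambda>P. f P - g P)"
    have g: "g \<in> series" using series unfolding mem_series g_def by (fastforce intro!: sum.neutral)
    have h: "h \<in> series"
      using g cyclic_elements_subset[OF f] by (auto simp: mem_series h_def)
    have "order_ge (Suc (length c)) h"
      unfolding order_ge_def
    proof (intro allI impI)
      fix u p assume *: "length (p :: 'e list) < Suc (length c)"
      have "g (u, p) = (\<Sum>p'\<in>S. if p' = p then f (u, p) * of_bool (u = tail Q (hd p)) else 0)"
        unfolding g_def by (intro sum.cong) (auto simp: single_def)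
      also have "\<dots> = f (u, p)"
        using S f * by (auto simp: cyclic_elements_def S_def)
      finally show "h (u, p) = 0" by (simp add: h_def)
    qed
    then have "potential_of Q (\<phi> h) w = 0"
      using potential_of_order_ge[OF order_ge_image[OF h]] c by simp
    moreover have "potential_of Q (\<phi> g) w = 0"
    proof -
      define F where "F = (\<lambda>p. potential_of Q (\<phi> (single (cycle_path p))) w)"
      have "potential_of Q (\<phi> g) w = (\<Sum>p\<in>S. f (cycle_path p) * F p)"
        unfolding g_def using series by (simp add: sum[OF S] potential_of_sum F_def)
      \<comment> \<open>\<open>S\<close> contains all rotations of its members and \<open>F\<close>
        is constant on each rotation class, so a class contributes a multiple of a coefficient of
        the zero potential.\<close>
      also have "\<dots> = (\<Sum>y\<in>cyclic_word ` S. \<Sum>p | p \<in> S \<and> cyclic_word p = y. f (cycle_path p) * F p)"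
        by (rule sum.image_gen[OF S])
      also have "\<dots> = (\<Sum>y\<in>cyclic_word ` S. 0)"
      proof (intro sum.cong refl)
        fix y assume "y \<in> cyclic_word ` S"
        then obtain d where d: "d \<in> S" "y = cyclic_word d" by blast
        have y: "{p. p \<in> S \<and> cyclic_word p = y} = y"
          using d cyclic_word_subset[of d] cyclic_word_eq[of _ d] length_in_cyclic_word[of _ d]
          by (auto simp: S_def) (metis self_in_cyclic_word)
        have "(\<Sum>p\<in>y. f (cycle_path p) * F p) = (\<Sum>p\<in>y. f (cycle_path p)) * F d"
          unfolding sum_distrib_right
          using d potential_of_rotated[of d] by (intro sum.cong) (auto simp: F_def S_def)
        also have "(\<Sum>p\<in>y. f (cycle_path p)) = potential_of Q f y"
          using d by (auto simp: potential_of_def S_def)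
        finally show "(\<Sum>p | p \<in> S \<and> cyclic_word p = y. f (cycle_path p) * F p) = 0"
          by (simp add: y f0)
      qed
      finally show ?thesis by simp
    qed
    moreover have "\<phi> f = (\<lambda>P. \<phi> g P + \<phi> h P)"
      using add[OF g h] by (simp add: h_def)
    ultimately show ?thesis by (simp add: potential_of_add)
  qed (simp add: potential_of_def)
qed

text \<open>The difference of two representatives represents zero. This makes the set under
  \<open>the_elem\<close> in \<open>act\<close> a singleton.\<close>

lemma potential_of_image_cong:
  assumes f: "f \<in> cyclic_elements Q" and g: "g \<in> cyclic_elements Q"
    and eq: "potential_of Q f = potential_of Q g"
  shows "potential_of Q (\<phi> f) = potential_of Q (\<phi> g)"
proof -
  define d where "d = (\<lambda>P. f P - g P)"
  have d: "d \<in> cyclic_elements Q" using f g by (auto simp: cyclic_elements_def d_def) metis+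
  have "potential_of Q d = (\<lambda>_. 0)"
    using eq potential_of_add[of Q d g] by (auto simp: d_def fun_eq_iff)
  then have "potential_of Q (\<phi> d) = (\<lambda>_. 0)" by (rule potential_of_image_eq_0[OF d])
  moreover have "\<phi> f = (\<lambda>P. \<phi> d P + \<phi> g P)"
    using add[OF cyclic_elements_subset[OF d] cyclic_elements_subset[OF g]] by (simp add: d_def)
  ultimately show ?thesis by (simp add: potential_of_add)
qed

lemma act_potential_of:
  assumes "f \<in> cyclic_elements Q"
  shows "act Q \<phi> (potential_of Q f) = potential_of Q (\<phi> f)"
proof -
  have "{potential_of Q (\<phi> g) | g. g \<in> cyclic_elements Q \<and> potential_of Q g = potential_of Q f}
      = {potential_of Q (\<phi> f)}"
    using assms potential_of_image_cong by blast
  then show ?thesis by (simp add: act_def)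
qed

end

section \<open>Right-equivalences acting on a torus of potentials\<close>

text \<open>Each row of \<open>M\<close> has exactly one nonzero entry. Since the map is onto, the positions of these
  entries form a permutation, and a permutation which nowhere increases \<open>len\<close> preserves it.\<close>

lemma torus_endomorphism_diagonal:
  fixes M :: "'z \<Rightarrow> 'z \<Rightarrow> 'k::field_char_0" and len :: "'z \<Rightarrow> nat"
  assumes fin: "finite Z"
    and into: "\<And>c q. \<forall>p\<in>Z. c p \<noteq> 0 \<Longrightarrow> q \<in> Z \<Longrightarrow> (\<Sum>p\<in>Z. c p * M q p) \<noteq> 0"
    and onto: "\<And>d. \<forall>p\<in>Z. d p \<noteq> 0 \<Longrightarrow>
      \<exists>c. (\<forall>p\<in>Z. c p \<noteq> 0) \<and> (\<forall>q\<in>Z. (\<Sum>p\<in>Z. c p * M q p) = d q)"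
    and le: "\<And>p q. p \<in> Z \<Longrightarrow> q \<in> Z \<Longrightarrow> M q p \<noteq> 0 \<Longrightarrow> len p \<le> len q"
    and eq: "\<And>p q. p \<in> Z \<Longrightarrow> q \<in> Z \<Longrightarrow> M q p \<noteq> 0 \<Longrightarrow> len p = len q \<Longrightarrow> p = q"
    and pq: "p \<in> Z" "q \<in> Z"
  shows "M q p \<noteq> 0 \<longleftrightarrow> p = q"
proof -
  have ex: "\<exists>p\<in>Z. M q p \<noteq> 0" if q: "q \<in> Z" for q
    using into[of "\<lambda>_. 1" q] q by (metis (no_types, lifting) mult_zero_right sum.neutral zero_neq_one)
  \<comment> \<open>A linear form with two nonzero coefficients vanishes somewhere on the torus.\<close>
  have unique: "p1 = p2" if q: "q \<in> Z" and p: "p1 \<in> Z" "p2 \<in> Z" "M q p1 \<noteq> 0" "M q p2 \<noteq> 0" for q p1 p2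
  proof (rule ccontr)
    assume ne: "p1 \<noteq> p2"
    define S where "S = (\<Sum>p \<in> Z - {p1, p2}. M q p)"
    \<comment> \<open>With value \<open>t\<close> at \<open>p1\<close> and \<open>1\<close>
      elsewhere, the value at \<open>p2\<close> is forced by requiring sum zero; it is nonzero
      exactly if \<open>S + t * M q p1\<close> is. That fails for at most one \<open>t\<close>, so
      \<open>1\<close> or \<open>2\<close> will do.\<close>
    obtain t where t: "t \<noteq> 0" "S + t * M q p1 \<noteq> 0"
    proof (cases "S + M q p1 = 0")
      case True
      then have "S + 2 * M q p1 = M q p1" by (metis add.left_neutral add.assoc mult_2)
      then have "S + 2 * M q p1 \<noteq> 0" using p by metis
      then show ?thesis using that[of 2] by simp
    next
      case False
      then show ?thesis using that[of 1] by simp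
    qed
    define c where "c = (\<lambda>p. if p = p1 then t else if p = p2 then - (S + t * M q p1) / M q p2 else 1)"
    have "(\<Sum>p\<in>Z. c p * M q p) = c p1 * M q p1 + (c p2 * M q p2 + (\<Sum>p \<in> Z - {p1, p2}. c p * M q p))"
    proof -
      have "Z - {p1} - {p2} = Z - {p1, p2}" by blast
      then show ?thesis
        using fin p ne by (simp add: sum.remove[of Z p1] sum.remove[of "Z - {p1}" p2])
    qed
    also have "(\<Sum>p \<in> Z - {p1, p2}. c p * M q p) = S"
      unfolding S_def by (intro sum.cong) (auto simp: c_def)
    also have "c p1 * M q p1 + (c p2 * M q p2 + S) = 0"
      using p ne by (simp add: c_def)
    finally have "(\<Sum>p\<in>Z. c p * M q p) = 0" .
    moreover have "\<forall>p\<in>Z. c p \<noteq> 0"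
      using t p(4) by (simp add: c_def del: minus_add_distrib)
    ultimately show False using into q by blast
  qed
  from ex obtain s where s: "\<And>q. q \<in> Z \<Longrightarrow> s q \<in> Z \<and> M q (s q) \<noteq> 0" by metis
  have sum_s: "(\<Sum>p\<in>Z. c p * M q p) = c (s q) * M q (s q)" if "q \<in> Z" for c q
  proof -
    have "(\<Sum>p\<in>Z. c p * M q p) = (\<Sum>p\<in>Z. if p = s q then c (s q) * M q (s q) else 0)"
      using unique that s by (intro sum.cong) auto
    then show ?thesis using s that fin by simp
  qed
  have inj: "inj_on s Z"
  proof (rule inj_onI, rule ccontr)
    \<comment> \<open>If two rows read the same coordinate, their outputs stand in a fixed ratio.
      Surjectivity attains both the ratio 1, with \<open>c\<close>, and the ratio 2, with
      \<open>d\<close>.\<close>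
    fix q r assume *: "q \<in> Z" "r \<in> Z" "s q = s r" "q \<noteq> r"
    obtain c where c: "\<forall>p\<in>Z. c p \<noteq> 0" "\<And>q. q \<in> Z \<Longrightarrow> c (s q) * M q (s q) = 1"
      using onto[of "\<lambda>_. 1"] sum_s by auto
    obtain d where d: "\<forall>p\<in>Z. d p \<noteq> 0"
      "\<And>q'. q' \<in> Z \<Longrightarrow> d (s q') * M q' (s q') = (if q' = q then 2 else 1)"
    proof -
      have "\<forall>p\<in>Z. (if p = q then 2 else 1 :: 'k) \<noteq> 0" by simp
      from onto[OF this] show ?thesis using that sum_s by auto
    qed
    have "M q (s q) = M r (s r)" using c(2)[of q] c(2)[of r] * s c(1) by (metis mult_left_cancel)
    then show False using d(2)[of q] d(2)[of r] * by simp
  qed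
  then have "bij_betw s Z Z"
    using fin s by (simp add: bij_betw_def endo_inj_surj image_subset_iff)
  \<comment> \<open>Equal totals turn the termwise inequalities into equalities.\<close>
  then have "(\<Sum>q\<in>Z. len (s q)) = (\<Sum>q\<in>Z. len q)"
    by (rule sum.reindex_bij_betw)
  then have "len (s q) = len q" if "q \<in> Z" for q
    using sum_mono_inv[of "\<lambda>q. len (s q)" Z len q] that le s fin by blast
  then have "s q = q" if "q \<in> Z" for q using eq s that by metis
  then show ?thesis using s unique pq by metis
qed

text \<open>The counterpart of \<open>primitive_potentials\<close> for an arbitrary set of cycles,
  which separates the analysis of orbits from the combinatorics of words.\<close>

definition torus_potentials :: "'e list set \<Rightarrow> ('e, 'k::field) potential set" where
  "torus_potentials Z = {cycle_combination Z c | c. \<forall>p\<in>Z. c p \<noteq> 0}"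

lemma cycle_combination_apply:
  assumes "finite Z" "inj_on cyclic_word Z" "q \<in> Z"
  shows "cycle_combination Z c (cyclic_word q) = c q"
proof -
  have "cycle_combination Z c (cyclic_word q) = (\<Sum>p\<in>Z. if p = q then c q else 0)"
    unfolding cycle_combination_def using assms(2,3) by (intro sum.cong) (auto dest: inj_onD)
  then show ?thesis using assms by simp
qed

lemma cycle_combination_cong:
  "(\<And>p. p \<in> Z \<Longrightarrow> c p = d p) \<Longrightarrow> cycle_combination Z c = cycle_combination Z d"
  unfolding cycle_combination_def by (intro ext sum.cong) auto

lemma cycle_combination_eq_iff:
  assumes "finite Z" "inj_on cyclic_word Z"
  shows "cycle_combination Z c = cycle_combination Z d \<longleftrightarrow> (\<forall>p\<in>Z. c p = d p)"
  using cycle_combination_apply[OF assms] cycle_combination_cong by metis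

text \<open>These are the properties of the cycles on which the description of orbits rests.
  \<open>inj_cyclic_word\<close> makes the coefficients of a combination coordinates, and
  \<open>no_parallel\<close> prevents transport between distinct cycles of equal length; other
  arrows of the quiver may well be parallel to those on the cycles.\<close>

locale cycle_system = finite_quiver Q for Q :: "('v, 'e) pre_digraph" (structure) +
  fixes Z :: "'e list set"
  assumes finite_cycles: "finite Z"
    and cycles_subset: "Z \<subseteq> cyclic_paths Q"
    and inj_cyclic_word: "inj_on cyclic_word Z"
    and no_parallel: "\<And>e e'. e \<in> \<Union>(set ` Z) \<Longrightarrow> e' \<in> \<Union>(set ` Z) \<Longrightarrow>
      tail Q e = tail Q e' \<Longrightarrow> head Q e = head Q e' \<Longrightarrow> e = e'"
begin

definition cycle_sum :: "('e list \<Rightarrow> 'k::field) \<Rightarrow> 'v \<times> 'e list \<Rightarrow> 'k" where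
  "cycle_sum c = (\<lambda>P. \<Sum>p\<in>Z. c p * single (cycle_path p) P)"

lemma cycle_sum_cyclic: "cycle_sum c \<in> cyclic_elements Q"
proof -
  have "cycle_sum c (u, p) = 0" if "\<not> (p \<in> cyclic_paths Q \<and> u = tail Q (hd p))" for u p
    using that cycles_subset unfolding cycle_sum_def
    by (intro sum.neutral) (auto simp: single_def)
  then show ?thesis unfolding cyclic_elements_def by blast
qed

lemma potential_of_cycle_sum: "potential_of Q (cycle_sum c) = cycle_combination Z c"
  using cycles_subset
  by (auto simp: cycle_sum_def potential_of_sum potential_of_single cycle_combination_def
      intro!: ext sum.cong)

end

section \<open>The matrix of a right-equivalence on the coefficients of cycles\<close>

locale cycle_system_equivalence = cycle_system Q Z + right_equivalence Q \<phi>
  for Q :: "('v, 'e) pre_digraph" (structure) and Z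
    and \<phi> :: "('v \<times> 'e list \<Rightarrow> 'k::field_char_0) \<Rightarrow> ('v \<times> 'e list \<Rightarrow> 'k)"
begin

text \<open>The matrix entry in row \<open>q\<close> and column \<open>p\<close>: what the cycle
  \<open>p\<close> contributes to the coefficient at \<open>q\<close>.\<close>

definition coef :: "'e list \<Rightarrow> 'e list \<Rightarrow> 'k" where
  "coef q p = potential_of Q (\<phi> (single (cycle_path p))) (cyclic_word q)"

lemma cycles_series: "p \<in> Z \<Longrightarrow> single (cycle_path p) \<in> series"
  using cycles_subset cycle_path_in_paths by (blast intro: single_series)

lemma act_cycle_combination:
  "act Q \<phi> (cycle_combination Z c) (cyclic_word q) = (\<Sum>p\<in>Z. c p * coef q p)"
proof -
  have "act Q \<phi> (cycle_combination Z c) = potential_of Q (\<phi> (cycle_sum c))"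
    using act_potential_of[OF cycle_sum_cyclic] by (simp add: potential_of_cycle_sum)
  also have "\<phi> (cycle_sum c) = (\<lambda>P. \<Sum>p\<in>Z. c p * \<phi> (single (cycle_path p)) P)"
    unfolding cycle_sum_def by (intro sum finite_cycles cycles_series)
  finally show ?thesis by (simp add: potential_of_sum coef_def)
qed

lemma coef_longer: "p \<in> Z \<Longrightarrow> length q < length p \<Longrightarrow> coef q p = 0"
  using order_ge_path_image[OF cycle_path_in_paths] cycles_subset
  unfolding coef_def by (blast intro: potential_of_order_ge)

text \<open>At equal length each arrow of \<open>p\<close> is replaced by a parallel one. Rotation
  keeps the set of arrows, so those of \<open>r\<close> lie on cycles and \<open>no_parallel\<close>
  applies. For \<open>q = p\<close> this also excludes contributions of proper rotations to the
  diagonal entry.\<close>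

lemma same_length_image:
  assumes "p \<in> Z" "q \<in> Z" "length q = length p" "r \<in> cyclic_word q"
    and nz: "\<phi> (single (cycle_path p)) (cycle_path r) \<noteq> 0"
  shows "r = p"
proof -
  have "list_all2 (\<lambda>e e'. tail Q e = tail Q e' \<and> head Q e = head Q e') p r"
    using nz assms cycles_subset cycle_path_in_paths
    by (intro path_image_parallel) (auto simp: length_in_cyclic_word)
  moreover have "set r = set q" using assms(4) by (auto simp: cyclic_word_def)
  ultimately show ?thesis
  proof (intro nth_equalityI)
    fix i assume par: "list_all2 (\<lambda>e e'. tail Q e = tail Q e' \<and> head Q e = head Q e') p r"
      and i: "i < length r" and set: "set r = set q"
    have "p ! i \<in> set p" "r ! i \<in> set q" using par i set by (auto simp: list_all2_conv_all_nth)
    then show "r ! i = p ! i"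
      using no_parallel[of "r ! i" "p ! i"] par i assms(1,2)
      unfolding list_all2_conv_all_nth by (metis UN_I)
  qed (simp add: list_all2_lengthD)
qed

lemma coef_same_length:
  assumes "p \<in> Z" "q \<in> Z" "length q = length p" "coef q p \<noteq> 0" shows "p = q"
proof -
  have "q \<in> cyclic_paths Q" using assms cycles_subset by blast
  then obtain r where r: "r \<in> cyclic_word q" "\<phi> (single (cycle_path p)) (cycle_path r) \<noteq> 0"
    using assms(4) unfolding coef_def potential_of_def
    by (auto elim: sum.not_neutral_contains_not_neutral)
  then have "p \<in> cyclic_word q" using same_length_image assms by blast
  then show ?thesis using cyclic_word_eq inj_cyclic_word assms by (metis inj_onD)
qed

lemma coef_diagonal:
  assumes "p \<in> Z"
  shows "coef p p = (\<Prod>e\<leftarrow>p. \<phi> (single (tail Q e, [e])) (tail Q e, [e]))"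
proof -
  have p: "p \<in> cyclic_paths Q" using assms cycles_subset by blast
  then have "coef p p = (\<Sum>r\<in>cyclic_word p. \<phi> (single (cycle_path p)) (cycle_path r))"
    by (auto simp: coef_def potential_of_def)
  also have "\<dots> = (\<Sum>r\<in>cyclic_word p. if r = p then \<phi> (single (cycle_path p)) (cycle_path p) else 0)"
    using same_length_image[OF assms assms refl] by (intro sum.cong) auto
  also have "\<dots> = \<phi> (single (cycle_path p)) (cycle_path p)"
    by (simp add: finite_cyclic_word self_in_cyclic_word)
  finally show ?thesis using path_image_diagonal[OF cycle_path_in_paths[OF p]] by simp
qed

theorem act_on_torus:
  assumes preserving: "act Q \<phi> ` torus_potentials Z = torus_potentials Z"
  obtains t where "\<And>e. t e \<noteq> 0"
    "\<And>c. \<forall>p\<in>Z. c p \<noteq> 0 \<Longrightarrow>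
      act Q \<phi> (cycle_combination Z c) = cycle_combination Z (\<lambda>p. c p * (\<Prod>e\<leftarrow>p. t e))"
proof -
  note coefficient = cycle_combination_apply[OF finite_cycles inj_cyclic_word]
  have image: "\<exists>d. (\<forall>p\<in>Z. d p \<noteq> 0) \<and> act Q \<phi> (cycle_combination Z c) = cycle_combination Z d
      \<and> (\<forall>q\<in>Z. d q = (\<Sum>p\<in>Z. c p * coef q p))"
    if c: "\<forall>p\<in>Z. c p \<noteq> 0" for c
  proof -
    have "cycle_combination Z c \<in> torus_potentials Z" using c by (auto simp: torus_potentials_def)
    then have "act Q \<phi> (cycle_combination Z c) \<in> torus_potentials Z" using preserving by blast
    then obtain d where d: "\<forall>p\<in>Z. d p \<noteq> 0" "act Q \<phi> (cycle_combination Z c) = cycle_combination Z d"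
      by (auto simp: torus_potentials_def)
    then show ?thesis using act_cycle_combination coefficient by metis
  qed
  have diag: "coef q p \<noteq> 0 \<longleftrightarrow> p = q" if "p \<in> Z" "q \<in> Z" for p q
  proof (rule torus_endomorphism_diagonal[where Z = Z and M = coef and len = length, OF finite_cycles])
    show "(\<Sum>p\<in>Z. c p * coef q p) \<noteq> 0" if "\<forall>p\<in>Z. c p \<noteq> 0" "q \<in> Z" for c q
      using image that by metis
    show "\<exists>c. (\<forall>p\<in>Z. c p \<noteq> 0) \<and> (\<forall>q\<in>Z. (\<Sum>p\<in>Z. c p * coef q p) = d q)" if d: "\<forall>p\<in>Z. d p \<noteq> 0" for d
    proof -
      have "cycle_combination Z d \<in> act Q \<phi> ` torus_potentials Z"
        unfolding preserving using d by (auto simp: torus_potentials_def)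
      then obtain c where "\<forall>p\<in>Z. c p \<noteq> 0" "cycle_combination Z d = act Q \<phi> (cycle_combination Z c)"
        by (auto simp: torus_potentials_def)
      then show ?thesis using act_cycle_combination coefficient by metis
    qed
  qed (use that coef_longer coef_same_length not_less in metis)+
  \<comment> \<open>A rescaling needs nonzero factors everywhere. The diagonal coefficient can
    vanish only at an \<open>e\<close> on no cycle, since its product along each cycle is nonzero,
    so the default \<open>1\<close> changes no cycle.\<close>
  define t where "t = (\<lambda>e. let s = \<phi> (single (tail Q e, [e])) (tail Q e, [e]) in if s = 0 then 1 else s)"
  have t: "coef p p = (\<Prod>e\<leftarrow>p. t e)" if p: "p \<in> Z" for p
  proof -
    have "(\<Prod>e\<leftarrow>p. \<phi> (single (tail Q e, [e])) (tail Q e, [e])) \<noteq> 0"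
      using diag[OF p p] coef_diagonal[OF p] by simp
    then show ?thesis unfolding coef_diagonal[OF p]
      by (intro arg_cong[of _ _ prod_list] map_cong refl) (auto simp: t_def Let_def prod_list_zero_iff)
  qed
  have "act Q \<phi> (cycle_combination Z c) = cycle_combination Z (\<lambda>p. c p * (\<Prod>e\<leftarrow>p. t e))"
    if c: "\<forall>p\<in>Z. c p \<noteq> 0" for c
  proof -
    obtain d where d: "act Q \<phi> (cycle_combination Z c) = cycle_combination Z d"
        "\<And>q. q \<in> Z \<Longrightarrow> d q = (\<Sum>p\<in>Z. c p * coef q p)"
      using image[OF c] by blast
    have "d q = c q * (\<Prod>e\<leftarrow>q. t e)" if q: "q \<in> Z" for q
    proof -
      have "(\<Sum>p\<in>Z. c p * coef q p) = (\<Sum>p\<in>Z. if p = q then c q * coef q q else 0)"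
        using diag q by (intro sum.cong) auto
      then show ?thesis using d(2)[OF q] t[OF q] q finite_cycles by simp
    qed
    then show ?thesis unfolding d(1) by (rule cycle_combination_cong)
  qed
  moreover have "t e \<noteq> 0" for e by (simp add: t_def Let_def)
  ultimately show thesis using that by blast
qed

end

section \<open>Rescaling of arrows\<close>

definition rescale :: "('e \<Rightarrow> 'k) \<Rightarrow> ('v \<times> 'e list \<Rightarrow> 'k) \<Rightarrow> 'v \<times> 'e list \<Rightarrow> 'k::field" where
  "rescale t f = (\<lambda>(u, p). (\<Prod>e\<leftarrow>p. t e) * f (u, p))"

context finite_quiver
begin

text \<open>The weight of a path is multiplicative under concatenation and equals 1 at vertices;
  reciprocal weights give the inverse.\<close>

lemma rescale_right_equivalence:
  assumes t: "\<And>e. t e \<noteq> (0 :: 'a)"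
  shows "(rescale t :: ('v \<times> 'e list \<Rightarrow> 'a::field) \<Rightarrow> _) \<in> right_equivalences Q"
proof -
  have closed: "rescale s f \<in> series" if "f \<in> series" for s and f :: "'v \<times> 'e list \<Rightarrow> 'a"
    using that by (auto simp: mem_series rescale_def)
  have inverse: "rescale r (rescale s f) = f" if rs: "\<And>e. r e * s e = 1" for r s :: "'e \<Rightarrow> 'a" and f :: "'v \<times> 'e list \<Rightarrow> 'a"
  proof -
    have "(\<Prod>e\<leftarrow>p. r e) * (\<Prod>e\<leftarrow>p. s e) = 1" for p
    proof (induction p)
      case (Cons e p)
      have "(\<Prod>e\<leftarrow>e # p. r e) * (\<Prod>e\<leftarrow>e # p. s e) = (r e * s e) * ((\<Prod>e\<leftarrow>p. r e) * (\<Prod>e\<leftarrow>p. s e))"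
        by (simp add: algebra_simps)
      then show ?case using Cons rs by simp
    qed simp
    then show ?thesis by (auto simp: rescale_def simp flip: mult.assoc)
  qed
  have "bij_betw (rescale t) series series"
    using t by (intro bij_betw_byWitness[where f' = "rescale (\<lambda>e. inverse (t e))"])
      (auto simp: closed inverse)
  moreover have "rescale t (f \<star> g) = rescale t f \<star> rescale t g" for f g :: "'v \<times> 'e list \<Rightarrow> 'a"
  proof (rule ext, clarify)
    fix u p
    have "(\<Prod>e\<leftarrow>p. t e) = (\<Prod>e\<leftarrow>take n p. t e) * (\<Prod>e\<leftarrow>drop n p. t e)" for n
      by (metis append_take_drop_id map_append prod_list.append)
    then show "rescale t (f \<star> g) (u, p) = (rescale t f \<star> rescale t g) (u, p)"
      unfolding rescale_def
      by (simp add: pmult_apply sum_distrib_left) (intro sum.cong refl, simp add: algebra_simps)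
  qed
  ultimately have "rescale t \<in> ring_iso (completed_path_algebra Q) (completed_path_algebra Q)"
    by (auto simp: ring_iso_def ring_hom_def closed add_series one_series)
      (auto simp: rescale_def algebra_simps)
  moreover have "rescale t f = f" if f: "f \<in> vertex_ring Q" for f :: "'v \<times> 'e list \<Rightarrow> 'a"
  proof (rule ext, clarify)
    fix u p show "rescale t f (u, p) = f (u, p)"
      using f by (cases "p = []") (simp_all add: vertex_ring_def rescale_def)
  qed
  ultimately show ?thesis by (simp add: right_equivalences_def)
qed

end

context cycle_system
begin

lemma act_rescale:
  fixes t :: "'e \<Rightarrow> 'a::field"
  assumes t: "\<And>e. t e \<noteq> 0"
  shows "act Q (rescale t) (cycle_combination Z c) = cycle_combination Z (\<lambda>p. c p * (\<Prod>e\<leftarrow>p. t e))"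
proof -
  interpret right_equivalence Q "rescale t :: ('v \<times> 'e list \<Rightarrow> 'a) \<Rightarrow> _"
    by unfold_locales (rule rescale_right_equivalence, rule t)
  have "rescale t (cycle_sum c) = cycle_sum (\<lambda>p. c p * (\<Prod>e\<leftarrow>p. t e))"
    by (auto simp: rescale_def cycle_sum_def single_def sum_distrib_left intro!: sum.cong)
  then show ?thesis
    using act_potential_of[OF cycle_sum_cyclic[of c]] by (simp add: potential_of_cycle_sum)
qed

lemma act_rescale_torus:
  fixes t :: "'e \<Rightarrow> 'a::field"
  assumes t: "\<And>e. t e \<noteq> 0"
  shows "act Q (rescale t) ` torus_potentials Z = torus_potentials Z"
proof (intro equalityI subsetI)
  fix W assume "W \<in> act Q (rescale t) ` torus_potentials Z"
  then obtain c where c: "\<forall>p\<in>Z. c p \<noteq> 0" "W = act Q (rescale t) (cycle_combination Z c)"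
    by (auto simp: torus_potentials_def)
  then have "W = cycle_combination Z (\<lambda>p. c p * (\<Prod>e\<leftarrow>p. t e))" using act_rescale[OF t] by simp
  moreover have "\<forall>p\<in>Z. c p * (\<Prod>e\<leftarrow>p. t e) \<noteq> 0" using c t by (auto simp: prod_list_zero_iff)
  ultimately show "W \<in> torus_potentials Z" unfolding torus_potentials_def by blast
next
  fix W :: "('e, 'a) potential" assume "W \<in> torus_potentials Z"
  then obtain c where c: "\<forall>p\<in>Z. c p \<noteq> 0" "W = cycle_combination Z c"
    by (auto simp: torus_potentials_def)
  define d where "d = (\<lambda>p. c p / (\<Prod>e\<leftarrow>p. t e))"
  have nz: "(\<Prod>e\<leftarrow>p. t e) \<noteq> 0" for p using t by (auto simp: prod_list_zero_iff)
  have "W = act Q (rescale t) (cycle_combination Z d)"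
    using act_rescale[OF t, where c = d] nz by (simp add: c d_def)
  moreover have "cycle_combination Z d \<in> torus_potentials Z"
    unfolding torus_potentials_def d_def using c nz by auto
  ultimately show "W \<in> act Q (rescale t) ` torus_potentials Z" by blast
qed

lemma orbit_iff:
  fixes c :: "'e list \<Rightarrow> 'k::field_char_0"
  assumes c: "\<forall>p\<in>Z. c p \<noteq> 0"
  shows "(\<exists>\<phi> \<in> right_equivalences Q. act Q \<phi> ` torus_potentials Z = torus_potentials Z
      \<and> W = act Q \<phi> (cycle_combination Z c))
    \<longleftrightarrow> (\<exists>t. (\<forall>e. t e \<noteq> 0) \<and> W = cycle_combination Z (\<lambda>p. c p * (\<Prod>e\<leftarrow>p. t e)))"
proof
  assume "\<exists>\<phi> \<in> right_equivalences Q. act Q \<phi> ` torus_potentials Z = torus_potentials Z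
      \<and> W = act Q \<phi> (cycle_combination Z c)"
  then obtain \<phi> where \<phi>: "\<phi> \<in> right_equivalences Q"
    "act Q \<phi> ` torus_potentials Z = torus_potentials Z" "W = act Q \<phi> (cycle_combination Z c)"
    by blast
  interpret cycle_system_equivalence Q Z \<phi> by unfold_locales (rule \<phi>(1))
  from act_on_torus[OF \<phi>(2)] show
    "\<exists>t. (\<forall>e. t e \<noteq> 0) \<and> W = cycle_combination Z (\<lambda>p. c p * (\<Prod>e\<leftarrow>p. t e))"
    using c \<phi>(3) by metis
next
  assume "\<exists>t. (\<forall>e. t e \<noteq> 0) \<and> W = cycle_combination Z (\<lambda>p. c p * (\<Prod>e\<leftarrow>p. t e))"
  then obtain t where t: "\<And>e. t e \<noteq> 0" "W = cycle_combination Z (\<lambda>p. c p * (\<Prod>e\<leftarrow>p. t e))"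
    by blast
  show "\<exists>\<phi> \<in> right_equivalences Q. act Q \<phi> ` torus_potentials Z = torus_potentials Z
      \<and> W = act Q \<phi> (cycle_combination Z c)"
  proof (intro bexI conjI)
    show "W = act Q (rescale t) (cycle_combination Z c)" using t by (simp add: act_rescale)
  qed (intro rescale_right_equivalence act_rescale_torus t(1))+
qed

end

section \<open>The cycles of a word\<close>

lemma quiver_simps [simp]:
  "verts (quiver V E x) = (SIGMA a:V. {..<mult_in x a})"
  "tail (quiver V E x) e = fst e"
  "head (quiver V E x) e = fst (snd e)"
  by (auto simp: quiver_def Let_def split: prod.splits)

lemma arcs_quiver:
  "(v, w, m) \<in> arcs (quiver V E x) \<longleftrightarrow> v \<in> verts (quiver V E x) \<and> w \<in> verts (quiver V E x)
    \<and> m < nat \<lfloor>signed_number E x v w\<rfloor>"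
  by (auto simp: quiver_def Let_def)

text \<open>Antisymmetry of \<open>unit_arrow\<close> settles this letter by letter; it is the
  source of loop-freeness.\<close>

lemma signed_number_self: "signed_number E x v v = 0"
proof -
  have "unit_arrow a b v v = 0" for a b by (auto simp: unit_arrow_def)
  then show ?thesis by (simp add: signed_number_def letter_contribution_def Let_def)
qed

lemma finite_quiver_quiver: assumes "finite V" shows "finite_quiver (quiver V E x)"
proof
  let ?Q = "quiver V E x"
  show "finite (verts ?Q)" using assms by simp
  then have "finite (SIGMA v:verts ?Q. SIGMA w:verts ?Q. {..<nat \<lfloor>signed_number E x v w\<rfloor>})"
    by (intro finite_SigmaI) auto
  moreover have "arcs ?Q \<subseteq> (SIGMA v:verts ?Q. SIGMA w:verts ?Q. {..<nat \<lfloor>signed_number E x v w\<rfloor>})"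
    by (auto simp: arcs_quiver)
  ultimately show "finite (arcs ?Q)" by (rule finite_subset[rotated])
  fix e assume e: "e \<in> arcs ?Q"
  obtain v w m where [simp]: "e = (v, w, m)" by (cases e)
  show "tail ?Q e \<in> verts ?Q" "head ?Q e \<in> verts ?Q" "tail ?Q e \<noteq> head ?Q e"
    using e by (auto simp: arcs_quiver signed_number_self)
qed

lemma closed_sequence_cyclic:
  assumes "vs \<noteq> []" "set (closed_sequence vs) \<subseteq> arcs (quiver V E x)"
  shows "closed_sequence vs \<in> cyclic_paths (quiver V E x)"
proof -
  obtain u us where vs: "vs = u # us" using assms by (cases vs) auto
  \<comment> \<open>The last vertex \<open>z\<close> is kept apart from the first, since the
    induction moves the first vertex along the walk.\<close>
  have cas: "pre_digraph.cas (quiver V E x) u (map (\<lambda>(v, w). (v, w, 0)) (zip (u # us) (us @ [z]))) z" for u us z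
    by (induction us arbitrary: u) (auto simp: pre_digraph.cas.simps)
  have ne: "closed_sequence vs \<noteq> []" by (cases us) (simp_all add: closed_sequence_def vs)
  have hd: "fst (hd (closed_sequence vs)) = u"
    by (cases us) (simp_all add: closed_sequence_def vs)
  have "hd (closed_sequence vs) \<in> arcs (quiver V E x)"
    using assms(2) ne hd_in_set by blast
  then have "u \<in> verts (quiver V E x)"
    using hd by (metis arcs_quiver prod.collapse)
  then show ?thesis
    using assms(2) ne hd cas[of u us u]
    by (simp add: cyclic_paths_def pre_digraph.awalk_def closed_sequence_def vs)
qed

section \<open>The arrows on a single cycle\<close>

lemma map_zip_maps: "map f (zip (map g xs) (map h xs)) = map (\<lambda>t. f (g t, h t)) xs"
  by (induction xs) auto

text \<open>Sorts the arrows into four kinds: the one from \<open>b\<close> to \<open>a\<close>, the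
  ascending steps over \<open>a\<close>, the one from \<open>a\<close> to \<open>b\<close>, and the
  descending steps over \<open>b\<close>.\<close>

lemma closed_sequence_run_nodes:
  fixes x a b p q
  defines "i \<equiv> passed x a (p + 1)" and "j \<equiv> passed x b (p + 1)"
  defines "k \<equiv> passed x a q - i" and "l \<equiv> passed x b q - j"
  shows "closed_sequence (run_nodes x a b p q)
    = (node x b j, node x a i, 0)
      # map (\<lambda>t. (node x a (i + t), node x a (i + Suc t), 0)) [0..<k]
      @ (node x a (i + k), node x b (j + l), 0)
      # map (\<lambda>t. (node x b (j + l - t), node x b (j + l - Suc t), 0)) [0..<l]"
proof -
  define f where "f = (\<lambda>t. node x a (i + t))"
  define g where "g = (\<lambda>t. node x b (j + l - t))"
  have "run_nodes x a b p q = node x b j # map f [0..<Suc k] @ map g [0..<l]"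
    by (simp add: run_nodes_def Let_def f_def g_def i_def j_def k_def l_def)
  \<comment> \<open>The vertex list and its rotation are both cut into pieces of lengths
    \<open>k + 1\<close> and \<open>l + 1\<close>, so that \<open>zip\<close> respects the cut. The
    vertex \<open>node x b j\<close> wrapped around by the rotation is \<open>g l\<close>.\<close>
  then have vs: "run_nodes x a b p q = (node x b j # map f [0..<k]) @ (f k # map g [0..<l])"
    by simp
  have "rotate1 (run_nodes x a b p q) = map f [0..<Suc k] @ map g [0..<Suc l]"
    by (simp add: vs) (simp add: g_def)
  also have "\<dots> = (f 0 # map (\<lambda>t. f (Suc t)) [0..<k]) @ (g 0 # map (\<lambda>t. g (Suc t)) [0..<l])"
    by (simp only: map_upt_Suc)
  finally have rot: "rotate1 (run_nodes x a b p q) = \<dots>" .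
  show ?thesis unfolding closed_sequence_def rot unfolding vs
    by (simp add: map_zip_maps) (simp add: f_def g_def)
qed

definition arrow_over :: "'a \<Rightarrow> 'a \<Rightarrow> 'a arrow \<Rightarrow> bool" where
  "arrow_over a b e \<longleftrightarrow> fst (fst e) = a \<and> fst (fst (snd e)) = b"

text \<open>A run contains a letter, so its cycle has at least one step over \<open>a\<close> or
  over \<open>b\<close>. Such a step reveals which of the two letters plays the role of
  \<open>a\<close>.\<close>

lemma passed_run:
  assumes "is_run x a b p q"
  shows "passed x a (p + 1) < passed x a q \<or> passed x b (p + 1) < passed x b q"
proof -
  obtain t where t: "p < t" "t < q" "cyc_nth x t \<in> {Plain a, Barred b}"
    using assms by (auto simp: is_run_def)
  have "passed x c (p + 1) < passed x c q" if "vtx (cyc_nth x t) = c" for c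
    unfolding passed_def
  proof (rule psubset_card_mono)
    show "{s. s < p + 1 \<and> vtx (cyc_nth x s) = c} \<subset> {s. s < q \<and> vtx (cyc_nth x s) = c}"
      using t that by (intro psubsetI) (auto simp: set_eq_iff intro!: exI[of _ t])
  qed simp
  then show ?thesis using t(3) by auto
qed

text \<open>What allows a cycle to be recovered from its cyclic word: the only arrow from
  \<open>b\<close> to \<open>a\<close> stands at the head and fixes the rotation, while the
  direction of the steps over \<open>a\<close> and \<open>b\<close> fixes the roles of the
  letters.\<close>

lemma ab_cycle_shape:
  assumes ab: "a \<noteq> b" and s: "s \<in> ab_cycles V E x a b"
  shows "s \<in> cyclic_paths (quiver V E x)" "set s \<subseteq> arcs (quiver V E x)"
    "\<And>e. e \<in> set s \<Longrightarrow> snd (snd e) = 0"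
    "arrow_over b a (hd s)" "\<And>e. e \<in> set (tl s) \<Longrightarrow> \<not> arrow_over b a e"
    "\<And>e. e \<in> set s \<Longrightarrow> arrow_over a a e \<Longrightarrow> snd (fst (snd e)) = Suc (snd (fst e)) mod mult_in x a"
    "\<And>e. e \<in> set s \<Longrightarrow> arrow_over b b e \<Longrightarrow> snd (fst e) = Suc (snd (fst (snd e))) mod mult_in x b"
    "\<exists>e\<in>set s. arrow_over a a e \<or> arrow_over b b e"
    "(\<lambda>e. fst (fst e)) ` set s = {a, b}"
proof -
  obtain p q where run: "is_run x a b p q" and s_eq: "s = closed_sequence (run_nodes x a b p q)"
    and arcs: "set s \<subseteq> arcs (quiver V E x)"
    using s by (auto simp: ab_cycles_def)
  show "set s \<subseteq> arcs (quiver V E x)" by (rule arcs)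
  have "run_nodes x a b p q \<noteq> []" by (simp add: run_nodes_def Let_def)
  then show "s \<in> cyclic_paths (quiver V E x)"
    using arcs unfolding s_eq by (rule closed_sequence_cyclic)
  note shape = s_eq[unfolded closed_sequence_run_nodes]
  show "\<And>e. e \<in> set s \<Longrightarrow> snd (snd e) = 0" unfolding shape by auto
  show "arrow_over b a (hd s)" unfolding shape by (simp add: arrow_over_def node_def)
  show "\<And>e. e \<in> set (tl s) \<Longrightarrow> \<not> arrow_over b a e"
    using ab unfolding shape by (auto simp: arrow_over_def node_def)
  show "\<And>e. e \<in> set s \<Longrightarrow> arrow_over a a e \<Longrightarrow> snd (fst (snd e)) = Suc (snd (fst e)) mod mult_in x a"
    using ab unfolding shape by (auto simp: arrow_over_def node_def mod_simps)
  have step: "(passed x b q - t) mod m = Suc (passed x b q - Suc t) mod m"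
    if "t < passed x b q - passed x b (Suc p)" for t m using that by (simp add: Suc_diff_Suc)
  show "\<And>e. e \<in> set s \<Longrightarrow> arrow_over b b e \<Longrightarrow> snd (fst e) = Suc (snd (fst (snd e))) mod mult_in x b"
    using ab unfolding shape
    by (auto simp: arrow_over_def node_def mod_simps step)
  show "\<exists>e\<in>set s. arrow_over a a e \<or> arrow_over b b e"
    using passed_run[OF run]
  proof
    assume "passed x a (p + 1) < passed x a q"
    \<comment> \<open>The witness is the term \<open>t = 0\<close> of the segment over
      \<open>a\<close>, spelled with \<open>+ 0\<close> and \<open>Suc 0\<close> to match the mapped
      function.\<close>
    then show ?thesis unfolding shape
      by (intro bexI[of _ "(node x a (passed x a (p + 1) + 0), node x a (passed x a (p + 1) + Suc 0), 0)"])
        (auto simp: arrow_over_def node_def image_iff intro!: bexI[of _ 0])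
  next
    assume *: "passed x b (p + 1) < passed x b q"
    let ?l = "passed x b q - passed x b (p + 1)"
    show ?thesis unfolding shape using *
      by (intro bexI[of _ "(node x b (passed x b (p + 1) + ?l - 0),
          node x b (passed x b (p + 1) + ?l - Suc 0), 0)"])
        (auto simp: arrow_over_def node_def image_iff intro!: bexI[of _ 0])
  qed
  show "(\<lambda>e. fst (fst e)) ` set s = {a, b}" unfolding shape by (auto simp: node_def image_iff)
qed

text \<open>Both congruences together would make \<open>n\<close> divide 2. This is how the bound of
  three letters per vertex enters.\<close>

lemma no_reversed_step:
  assumes "3 \<le> n" "s < n" "t < n" "t = Suc s mod n" shows "s \<noteq> Suc t mod n"
  using assms by (auto simp: mod_Suc split: if_splits)

text \<open>A rotation by a nonzero amount modulo the length starts with an entry of the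
  tail.\<close>

lemma rotate_unique_head:
  assumes "s \<noteq> []" "P (hd (rotate n s))" "\<And>e. e \<in> set (tl s) \<Longrightarrow> \<not> P e"
  shows "rotate n s = s"
proof (cases "n mod length s = 0")
  case True
  then show ?thesis using rotate_conv_mod[of n s] by simp
next
  case False
  then obtain m where m: "n mod length s = Suc m" by (cases "n mod length s") auto
  have "hd (rotate n s) = tl s ! m"
    using m assms(1) by (cases s) (simp_all add: hd_rotate_conv_nth)
  moreover have "m < length (tl s)"
    using m assms(1) mod_less_divisor[of "length s" n] by (cases s) auto
  ultimately show ?thesis using assms(2,3) nth_mem by metis
qed

section \<open>Cycles as elements of a cycle system\<close>

context
  fixes V :: "'a set" and E x
  assumes graph: "simple_graph V E" and three: "\<forall>a\<in>V. mult_in x a \<ge> 3"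
begin

lemma edgeD: "(a, b) \<in> E \<Longrightarrow> a \<in> V \<and> b \<in> V \<and> a \<noteq> b"
  using graph by (auto simp: simple_graph_def irrefl_def)

text \<open>The letters met determine the unordered pair. With equal roles the unique arrow from
  \<open>b\<close> to \<open>a\<close> fixes the rotation; with exchanged roles a step over a single
  letter would have to both raise and lower the index.\<close>

lemma inj_cyclic_word_all_cycles: "inj_on cyclic_word (all_cycles V E x)"
proof (rule inj_onI)
  fix s s' assume "s \<in> all_cycles V E x" "s' \<in> all_cycles V E x" and eq: "cyclic_word s = cyclic_word s'"
  then obtain a b c d where ab: "(a, b) \<in> E" "s \<in> ab_cycles V E x a b"
    and cd: "(c, d) \<in> E" "s' \<in> ab_cycles V E x c d"
    by (auto simp: all_cycles_def)
  have "a \<noteq> b" "c \<noteq> d" using ab cd edgeD by auto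
  note shape = ab_cycle_shape[OF \<open>a \<noteq> b\<close> ab(2)] and shape' = ab_cycle_shape[OF \<open>c \<noteq> d\<close> cd(2)]
  obtain n where n: "s' = rotate n s" using eq self_in_cyclic_word[of s'] by (auto simp: cyclic_word_def)
  then have set: "set s' = set s" by simp
  then have "{a, b} = {c, d}" using shape(9) shape'(9) by metis
  then consider "c = a" "d = b" | "c = b" "d = a" by (auto simp: doubleton_eq_iff)
  then show "s = s'"
  proof cases
    case 1
    have "s \<noteq> []" using shape(8) by auto
    then show ?thesis
      using rotate_unique_head[of s "arrow_over b a" n] shape(5) shape'(4) n 1 by auto
  next
    case 2
    have *: False if e: "e \<in> set s" "arrow_over f f e" and f: "f = a \<or> f = b" for e f
    proof -
      obtain i i' m where [simp]: "e = ((f, i), (f, i'), m)"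
        using e(2) by (cases e) (auto simp: arrow_over_def)
      have "e \<in> arcs (quiver V E x)" using shape(2) e by blast
      then have "i < mult_in x f" "i' < mult_in x f" "f \<in> V" by (auto simp: arcs_quiver)
      moreover have "3 \<le> mult_in x f" using three \<open>f \<in> V\<close> by blast
      ultimately show False
        using shape(6,7)[OF e(1)] shape'(6,7)[of e] e f set 2
          no_reversed_step[of "mult_in x f" i i'] no_reversed_step[of "mult_in x f" i' i]
        by auto
    qed
    then show ?thesis using shape(8) by blast
  qed
qed

lemma finite_all_cycles: "finite (all_cycles V E x)"
proof -
  have "finite E" using graph finite_subset[of E "V \<times> V"] by (simp add: simple_graph_def)
  moreover have "finite (ab_cycles V E x a b)" for a b
  proof -
    \<comment> \<open>The delimiter at \<open>p\<close> recurs one period later, so the next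
      delimiter comes no later than that.\<close>
    have bound: "q \<le> p + length x" if run: "is_run x a b p q" for p q
    proof (rule ccontr)
      assume "\<not> q \<le> p + length x"
      moreover have "cyc_nth x (p + length x) = cyc_nth x p" by (simp add: cyc_nth_def)
      moreover have "p < p + length x" using run by (auto simp: is_run_def)
      ultimately show False using run unfolding is_run_def by (metis not_le)
    qed
    have "p < length x \<and> q \<le> 2 * length x" if "is_run x a b p q" for p q
    proof -
      have "p < length x" using that by (simp add: is_run_def)
      moreover have "q \<le> p + length x" using that by (rule bound)
      ultimately show ?thesis by simp
    qed
    then have "ab_cycles V E x a b \<subseteq> (\<lambda>(p, q). closed_sequence (run_nodes x a b p q))
        ` ({..<length x} \<times> {..2 * length x})"
      unfolding ab_cycles_def by auto
    then show ?thesis by (rule finite_subset) simp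
  qed
  ultimately show ?thesis by (auto simp: all_cycles_def)
qed

text \<open>Cycles only use the arrow numbered 0 between two vertices, so their arrows are
  determined by the endpoints even where two arrows add up.\<close>

lemma all_cycles_cycle_system: "cycle_system (quiver V E x) (all_cycles V E x)"
proof -
  interpret finite_quiver "quiver V E x"
    using graph by (intro finite_quiver_quiver) (simp add: simple_graph_def)
  have cyc: "s \<in> cyclic_paths (quiver V E x)" "\<And>e. e \<in> set s \<Longrightarrow> snd (snd e) = 0"
    if "s \<in> all_cycles V E x" for s
  proof -
    obtain a b where "(a, b) \<in> E" "s \<in> ab_cycles V E x a b"
      using \<open>s \<in> all_cycles V E x\<close> by (auto simp: all_cycles_def)
    then show "s \<in> cyclic_paths (quiver V E x)" "\<And>e. e \<in> set s \<Longrightarrow> snd (snd e) = 0"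
      using ab_cycle_shape(1,3)[of a b s] edgeD by blast+
  qed
  show ?thesis
  proof
    show "all_cycles V E x \<subseteq> cyclic_paths (quiver V E x)" using cyc by blast
    fix e e' assume "e \<in> \<Union>(set ` all_cycles V E x)" "e' \<in> \<Union>(set ` all_cycles V E x)"
      "tail (quiver V E x) e = tail (quiver V E x) e'" "head (quiver V E x) e = head (quiver V E x) e'"
    moreover from this have "snd (snd e) = 0" "snd (snd e') = 0" using cyc(2) by blast+
    ultimately show "e = e'" by (simp add: prod_eq_iff)
  qed (rule finite_all_cycles inj_cyclic_word_all_cycles)+
qed

end

section \<open>Orbits and cohomology\<close>

lemma prod_list_map_mult: "(\<Prod>e\<leftarrow>p. f e * g e) = (\<Prod>e\<leftarrow>p. f e) * (\<Prod>e\<leftarrow>p. g e :: 'b::comm_monoid_mult)"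
  by (induction p) (simp_all add: algebra_simps)

text \<open>Relates the two descriptions of a 2-cell: a list of arrows, and a boundary chain
  recording multiplicities.\<close>

lemma prod_list_map_eq_prod_count:
  "(\<Prod>e\<leftarrow>p. f e) = (\<Prod>e\<in>set p. f e ^ count_list p e :: 'b::comm_monoid_mult)"
proof (induction p)
  case (Cons a p)
  have "(\<Prod>e\<in>set (a # p). f e ^ count_list (a # p) e)
      = (\<Prod>e\<in>insert a (set p). (if e = a then f a else 1) * f e ^ count_list p e)"
    by (intro prod.cong) auto
  also have "\<dots> = f a * (\<Prod>e\<in>insert a (set p). f e ^ count_list p e)"
    by (simp add: prod.distrib)
  also have "(\<Prod>e\<in>insert a (set p). f e ^ count_list p e) = (\<Prod>e\<in>set p. f e ^ count_list p e)"
    by (intro prod.mono_neutral_right) (auto simp: count_list_0_iff)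
  finally show ?case using Cons by simp
qed simp

lemma multiplicative_group_simps [simp]:
  "carrier multiplicative_group = UNIV - {0}"
  "f \<otimes>\<^bsub>multiplicative_group\<^esub> g = f * g"
  "\<one>\<^bsub>multiplicative_group\<^esub> = 1"
  by (simp_all add: multiplicative_group_def)

lemma comm_group_multiplicative_group: "comm_group (multiplicative_group :: 'k::field monoid)"
proof (rule comm_groupI)
  fix f :: 'k assume "f \<in> carrier multiplicative_group"
  then show "\<exists>g\<in>carrier multiplicative_group. g \<otimes>\<^bsub>multiplicative_group\<^esub> f = \<one>\<^bsub>multiplicative_group\<^esub>"
    by (intro bexI[of _ "inverse f"]) auto
qed (auto simp: algebra_simps)

interpretation kx: comm_group "multiplicative_group :: 'k::field monoid"
  by (rule comm_group_multiplicative_group)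

lemma int_pow_multiplicative_group:
  "f [^]\<^bsub>multiplicative_group\<^esub> int n = (f ^ n :: 'k::field)"
proof -
  have "f [^]\<^bsub>multiplicative_group\<^esub> n = f ^ n"
    by (induction n) (simp_all add: algebra_simps)
  then show ?thesis by (simp add: int_pow_int)
qed

lemma finprod_multiplicative_group:
  assumes "finite S" "\<And>s. s \<in> S \<Longrightarrow> f s \<noteq> (0 :: 'k::field)"
  shows "finprod multiplicative_group f S = prod f S"
  using assms by (induction S rule: finite_induct) (auto simp: kx.finprod_insert)

lemma lookup_sum_frag_of: "Poly_Mapping.lookup (\<Sum>e\<leftarrow>p. frag_of (g e)) t = int (count_list (map g p) t)"
  by (induction p) (auto simp: lookup_add)

text \<open>The coefficients of the boundary count occurrences in \<open>p\<close>, so the integer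
  powers are ordinary ones and collect into the product along the cycle.\<close>

lemma coboundary_word_complex:
  fixes f :: "'a word_cell \<Rightarrow> 'k::field"
  assumes "p \<in> all_cycles V E x" "\<And>e. e \<in> set p \<Longrightarrow> f (Cell1 e) \<noteq> 0"
  shows "coboundary (word_complex V E x) multiplicative_group 1 f (Cell2 p) = (\<Prod>e\<leftarrow>p. f (Cell1 e))"
proof -
  let ?b = "\<Sum>e\<leftarrow>p. frag_of (Cell1 e) :: 'a word_cell \<Rightarrow>\<^sub>0 int"
  have keys: "Poly_Mapping.keys ?b = set (map Cell1 p)"
    by (auto simp: in_keys_iff lookup_sum_frag_of count_list_0_iff simp del: set_map)
  have "coboundary (word_complex V E x) multiplicative_group 1 f (Cell2 p)
      = (\<Otimes>\<^bsub>multiplicative_group\<^esub>t \<in> set (map Cell1 p). f t [^]\<^bsub>multiplicative_group\<^esub> Poly_Mapping.lookup ?b t)"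
    using assms(1) by (simp add: coboundary_def word_complex_def keys del: set_map)
  also have "\<dots> = (\<Otimes>\<^bsub>multiplicative_group\<^esub>t \<in> set (map Cell1 p). f t ^ count_list (map Cell1 p) t)"
    by (simp only: lookup_sum_frag_of int_pow_multiplicative_group)
  also have "\<dots> = (\<Prod>t \<in> set (map Cell1 p). f t ^ count_list (map Cell1 p) t)"
    using assms(2) by (intro finprod_multiplicative_group) auto
  also have "\<dots> = (\<Prod>e\<leftarrow>map Cell1 p. f e)" by (rule prod_list_map_eq_prod_count[symmetric])
  finally show ?thesis by (simp add: comp_def)
qed

lemma word_complex_cells:
  "cells (word_complex V E x) 1 = Cell1 ` arcs (quiver V E x)"
  "cells (word_complex V E x) 2 = Cell2 ` all_cycles V E x"
  "cells (word_complex V E x) 3 = {}"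
  by (simp_all add: word_complex_def)

text \<open>Without 3-cells the next coboundary takes values in the trivial group, so every
  2-cochain is a cocycle.\<close>

lemma cohomology_group_2:
  "cohomology_group 2 (word_complex V E x) multiplicative_group =
    cochains (word_complex V E x) multiplicative_group 2
      Mod coboundary (word_complex V E x) multiplicative_group 1
        ` carrier (cochains (word_complex V E x) multiplicative_group 1)"
proof -
  let ?K = "word_complex V E x" and ?A = "multiplicative_group :: 'b monoid"
  have "cocycles ?K ?A 2 = carrier (cochains ?K ?A 2)"
    using word_complex_cells(3)[of V E x]
    by (auto simp: cocycles_def cochains_def coboundary_def numeral_3_eq_3 numeral_2_eq_2)
  moreover have "coboundaries ?K ?A 2 = coboundary ?K ?A 1 ` carrier (cochains ?K ?A 1)"
    by (simp add: numeral_2_eq_2)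
  ultimately show ?thesis by (simp add: cohomology_group_def)
qed

lemma primitive_potentials_eq: "primitive_potentials V E x = torus_potentials (all_cycles V E x)"
  by (simp add: primitive_potentials_def torus_potentials_def)

text \<open>The parameter \<open>k\<close> only fixes the field.\<close>

locale word_quiver =
  fixes V :: "'a set" and E x and k :: "'k::field_char_0 itself"
  assumes graph: "simple_graph V E" and three: "\<forall>a\<in>V. mult_in x a \<ge> 3"
begin

sublocale cycle_system "quiver V E x" "all_cycles V E x"
  by (rule all_cycles_cycle_system[OF graph three])

abbreviation Z where "Z \<equiv> all_cycles V E x"
abbreviation K where "K \<equiv> word_complex V E x"
abbreviation kx where "kx \<equiv> multiplicative_group :: 'k monoid"
abbreviation T where "T \<equiv> primitive_torus V E x :: ('a arrow, 'k) potential monoid"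

text \<open>The dictionary between cohomology and potentials: the value on a cell becomes the
  coefficient of its cycle.\<close>

definition potential_of_cochain :: "('a word_cell \<Rightarrow> 'k) \<Rightarrow> ('a arrow, 'k) potential" where
  "potential_of_cochain f = cycle_combination Z (\<lambda>p. f (Cell2 p))"

lemma cochain_1: "f \<in> carrier (cochains K kx 1) \<longleftrightarrow> f \<in> Cell1 ` arcs (quiver V E x) \<rightarrow>\<^sub>E UNIV - {0}"
  unfolding cochains_def word_complex_cells by simp

lemma cochain_2: "f \<in> carrier (cochains K kx 2) \<longleftrightarrow> f \<in> Cell2 ` Z \<rightarrow>\<^sub>E UNIV - {0}"
  unfolding cochains_def word_complex_cells by simp

lemma cochains_group: "group (cochains K kx n)"
  unfolding cochains_def by (intro product_group) (rule kx.group_axioms)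

lemma torus_simps:
  "carrier T = torus_potentials Z"
  "W \<otimes>\<^bsub>T\<^esub> W' = (\<lambda>w. W w * W' w)"
  "\<one>\<^bsub>T\<^esub> = cycle_combination Z (\<lambda>_. 1)"
  by (simp_all add: primitive_torus_def primitive_potentials_eq)

text \<open>Distinct cycles have distinct cyclic words, so the pointwise product has no mixed
  terms.\<close>

lemma cycle_combination_mult:
  "cycle_combination Z c \<otimes>\<^bsub>T\<^esub> cycle_combination Z d = cycle_combination Z (\<lambda>p. c p * d p)"
proof
  fix w
  show "(cycle_combination Z c \<otimes>\<^bsub>T\<^esub> cycle_combination Z d) w = cycle_combination Z (\<lambda>p. c p * d p) w"
  proof (cases "w \<in> cyclic_word ` Z")
    case True
    then show ?thesis
      by (auto simp: torus_simps cycle_combination_apply[OF finite_cycles inj_cyclic_word])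
  next
    case False
    then have "cycle_combination Z c w = 0" for c :: "'a arrow list \<Rightarrow> 'k"
      unfolding cycle_combination_def by (intro sum.neutral) auto
    then show ?thesis by (simp add: torus_simps)
  qed
qed

lemma set_cycle_subset: "p \<in> Z \<Longrightarrow> set p \<subseteq> arcs (quiver V E x)"
  using cycles_subset by (auto simp: cyclic_paths_def awalk_def)

lemma potential_of_cochain_hom: "potential_of_cochain \<in> hom (cochains K kx 2) T"
proof (rule homI)
  fix f g assume f: "f \<in> carrier (cochains K kx 2)"
  then show "potential_of_cochain f \<in> carrier T"
    unfolding cochain_2 by (auto simp: torus_simps torus_potentials_def potential_of_cochain_def)
  have "f \<otimes>\<^bsub>cochains K kx 2\<^esub> g = (\<lambda>i \<in> Cell2 ` Z. f i * g i)"
    by (simp add: cochains_def word_complex_cells)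
  then show "potential_of_cochain (f \<otimes>\<^bsub>cochains K kx 2\<^esub> g)
      = potential_of_cochain f \<otimes>\<^bsub>T\<^esub> potential_of_cochain g"
    unfolding potential_of_cochain_def cycle_combination_mult
    by (intro cycle_combination_cong) simp
qed

lemma inj_potential_of_cochain: "inj_on potential_of_cochain (carrier (cochains K kx 2))"
proof (rule inj_onI)
  fix f g assume *: "f \<in> carrier (cochains K kx 2)" "g \<in> carrier (cochains K kx 2)"
    "potential_of_cochain f = potential_of_cochain g"
  then have "\<forall>p\<in>Z. f (Cell2 p) = g (Cell2 p)"
    unfolding potential_of_cochain_def cycle_combination_eq_iff[OF finite_cycles inj_cyclic_word] by simp
  then show "f = g" using *(1,2) unfolding cochain_2 by (intro PiE_ext) auto
qed

lemma potential_of_cochain_onto: "potential_of_cochain ` carrier (cochains K kx 2) = carrier T"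
proof (intro equalityI subsetI)
  fix W assume "W \<in> carrier T"
  then obtain c where c: "\<forall>p\<in>Z. c p \<noteq> 0" "W = cycle_combination Z c"
    by (auto simp: torus_simps torus_potentials_def)
  \<comment> \<open>The value \<open>1\<close> on other kinds of cells is arbitrary, since the
    domain contains 2-cells only.\<close>
  define f where "f = (\<lambda>s \<in> Cell2 ` Z. case s of Cell2 p \<Rightarrow> c p | _ \<Rightarrow> 1)"
  have "f \<in> carrier (cochains K kx 2)" using c unfolding cochain_2 f_def by auto
  moreover have "W = potential_of_cochain f"
    unfolding c(2) potential_of_cochain_def by (intro cycle_combination_cong) (simp add: f_def)
  ultimately show "W \<in> potential_of_cochain ` carrier (cochains K kx 2)" by blast
qed (use potential_of_cochain_hom in \<open>auto simp: hom_def\<close>)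

text \<open>The group axioms are transported from the product group of 2-cochains along a surjective
  homomorphism.\<close>

lemma torus_comm_group: "comm_group T"
proof -
  have "potential_of_cochain \<one>\<^bsub>cochains K kx 2\<^esub> = \<one>\<^bsub>T\<^esub>"
    unfolding potential_of_cochain_def torus_simps
    by (intro cycle_combination_cong) (simp add: cochains_def word_complex_cells)
  then have "group T"
    using group.hom_imp_img_group[OF cochains_group potential_of_cochain_hom]
    by (simp add: potential_of_cochain_onto)
  then show ?thesis by (rule group.group_comm_groupI) (simp add: torus_simps mult.commute)
qed

lemma coboundary_hom: "coboundary K kx 1 \<in> hom (cochains K kx 1) (cochains K kx 2)"
proof (rule homI)
  have nz: "f (Cell1 e) \<noteq> 0" if "f \<in> carrier (cochains K kx 1)" "p \<in> Z" "e \<in> set p" for f p e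
    using that set_cycle_subset[of p] unfolding cochain_1 by auto
  have evaluate: "coboundary K kx 1 f (Cell2 p) = (\<Prod>e\<leftarrow>p. f (Cell1 e))"
    if "f \<in> carrier (cochains K kx 1)" "p \<in> Z" for f p
    using coboundary_word_complex[where f = f, OF that(2)] nz[OF that] by blast
  have ext: "coboundary K kx 1 f \<in> extensional (Cell2 ` Z)" for f
    by (simp add: coboundary_def word_complex_def)
  fix f g assume f: "f \<in> carrier (cochains K kx 1)" and g: "g \<in> carrier (cochains K kx 1)"
  have closed: "coboundary K kx 1 f \<in> carrier (cochains K kx 2)" if "f \<in> carrier (cochains K kx 1)" for f
  proof -
    have "coboundary K kx 1 f (Cell2 p) \<noteq> 0" if "p \<in> Z" for p
      unfolding evaluate[OF \<open>f \<in> _\<close> that] using nz[OF \<open>f \<in> _\<close> that]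
      by (auto simp: prod_list_zero_iff)
    then show ?thesis unfolding cochain_2 using ext by (auto simp: PiE_iff)
  qed
  then show "coboundary K kx 1 f \<in> carrier (cochains K kx 2)" using f .
  have fg: "f \<otimes>\<^bsub>cochains K kx 1\<^esub> g \<in> carrier (cochains K kx 1)"
    using f g by (intro monoid.m_closed group.is_monoid[OF cochains_group])
  have "f \<otimes>\<^bsub>cochains K kx 1\<^esub> g = (\<lambda>i \<in> Cell1 ` arcs (quiver V E x). f i * g i)"
    unfolding cochains_def word_complex_cells by simp
  then have mult: "(f \<otimes>\<^bsub>cochains K kx 1\<^esub> g) (Cell1 e) = f (Cell1 e) * g (Cell1 e)"
    if "p \<in> Z" "e \<in> set p" for p e
    using that set_cycle_subset[of p] by auto
  have mult2: "coboundary K kx 1 f \<otimes>\<^bsub>cochains K kx 2\<^esub> coboundary K kx 1 g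
      = (\<lambda>i \<in> Cell2 ` Z. coboundary K kx 1 f i * coboundary K kx 1 g i)"
    by (simp add: cochains_def word_complex_cells)
  show "coboundary K kx 1 (f \<otimes>\<^bsub>cochains K kx 1\<^esub> g)
      = coboundary K kx 1 f \<otimes>\<^bsub>cochains K kx 2\<^esub> coboundary K kx 1 g"
    unfolding mult2
  proof (rule extensionalityI[OF ext])
    fix s assume "s \<in> Cell2 ` Z"
    then obtain p where p: "p \<in> Z" "s = Cell2 p" by blast
    have "(\<Prod>e\<leftarrow>p. (f \<otimes>\<^bsub>cochains K kx 1\<^esub> g) (Cell1 e)) = (\<Prod>e\<leftarrow>p. f (Cell1 e) * g (Cell1 e))"
      using mult[OF p(1)] by (intro arg_cong[of _ _ prod_list] map_cong) auto
    then show "coboundary K kx 1 (f \<otimes>\<^bsub>cochains K kx 1\<^esub> g) s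
        = (\<lambda>i \<in> Cell2 ` Z. coboundary K kx 1 f i * coboundary K kx 1 g i) s"
      using p by (simp add: evaluate[OF f] evaluate[OF g] evaluate[OF fg] prod_list_map_mult del: One_nat_def)
  qed simp
qed

section \<open>Coboundaries inside the torus, and orbits as their cosets\<close>

definition B where "B = coboundary K kx 1 ` carrier (cochains K kx 1)"

text \<open>This subgroup turns out to be the orbit of the potential with all coefficients
  1.\<close>

definition N where "N = potential_of_cochain ` B"

lemma B_subset: "B \<subseteq> carrier (cochains K kx 2)"
  using coboundary_hom by (auto simp: B_def hom_def)

lemma N_subgroup: "subgroup N T"
proof -
  have "potential_of_cochain \<circ> coboundary K kx 1 \<in> hom (cochains K kx 1) T"
    by (rule Group.hom_compose[OF coboundary_hom potential_of_cochain_hom])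
  then have "group_hom (cochains K kx 1) T (potential_of_cochain \<circ> coboundary K kx 1)"
    using cochains_group torus_comm_group
    by (simp add: group_hom_def group_hom_axioms_def comm_group_def)
  from group_hom.img_is_subgroup[OF this] show ?thesis
    by (simp add: N_def B_def image_comp)
qed

lemma N_eq: "N = {cycle_combination Z (\<lambda>p. \<Prod>e\<leftarrow>p. t e) | t. \<forall>e. t e \<noteq> 0}"
proof (intro equalityI subsetI)
  fix W assume "W \<in> N"
  then obtain f where f: "f \<in> carrier (cochains K kx 1)"
    and W: "W = potential_of_cochain (coboundary K kx 1 f)" by (auto simp: N_def B_def)
  \<comment> \<open>A 1-cochain is specified on arrows only, while \<open>t\<close> must be nonzero
    everywhere; cycles never see the default.\<close>
  define t where "t = (\<lambda>e. if e \<in> arcs (quiver V E x) then f (Cell1 e) else 1)"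
  have t: "\<forall>e. t e \<noteq> 0" using f unfolding cochain_1 by (auto simp: t_def)
  have "W = cycle_combination Z (\<lambda>p. \<Prod>e\<leftarrow>p. t e)"
    unfolding W potential_of_cochain_def
  proof (rule cycle_combination_cong)
    fix p assume p: "p \<in> Z"
    have eq: "f (Cell1 e) = t e" if "e \<in> set p" for e
      using set_cycle_subset[OF p] that by (auto simp: t_def)
    have "coboundary K kx 1 f (Cell2 p) = (\<Prod>e\<leftarrow>p. f (Cell1 e))"
      using p eq t by (intro coboundary_word_complex) auto
    then show "coboundary K kx 1 f (Cell2 p) = (\<Prod>e\<leftarrow>p. t e)"
      using eq by (simp cong: map_cong)
  qed
  then show "W \<in> {cycle_combination Z (\<lambda>p. \<Prod>e\<leftarrow>p. t e) | t. \<forall>e. t e \<noteq> 0}" using t by blast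
next
  fix W assume "W \<in> {cycle_combination Z (\<lambda>p. \<Prod>e\<leftarrow>p. t e :: 'k) | t. \<forall>e. t e \<noteq> 0}"
  then obtain t where t: "\<forall>e. t e \<noteq> 0" and W: "W = cycle_combination Z (\<lambda>p. \<Prod>e\<leftarrow>p. t e)" by blast
  define f where "f = (\<lambda>s \<in> Cell1 ` arcs (quiver V E x). case s of Cell1 e \<Rightarrow> t e | _ \<Rightarrow> 1)"
  have f: "f \<in> carrier (cochains K kx 1)" using t unfolding cochain_1 f_def by auto
  have "W = potential_of_cochain (coboundary K kx 1 f)"
    unfolding W potential_of_cochain_def
  proof (rule cycle_combination_cong)
    fix p assume p: "p \<in> Z"
    have eq: "f (Cell1 e) = t e" if "e \<in> set p" for e
      using set_cycle_subset[OF p] that by (auto simp: f_def)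
    have "coboundary K kx 1 f (Cell2 p) = (\<Prod>e\<leftarrow>p. f (Cell1 e))"
      using p eq t by (intro coboundary_word_complex) auto
    then show "(\<Prod>e\<leftarrow>p. t e) = coboundary K kx 1 f (Cell2 p)"
      using eq by (simp cong: map_cong)
  qed
  then show "W \<in> N" using f by (auto simp: N_def B_def)
qed

text \<open>Rescaling arrows multiplies each coefficient by the product along its cycle, which is
  translation by an element of \<open>N\<close>. Multiplication of orbits as subsets thereby becomes
  multiplication of cosets.\<close>

lemma orbit_eq_coset:
  assumes W: "W \<in> carrier T"
  shows "orbit_relation V E x `` {W} = N #>\<^bsub>T\<^esub> W"
proof -
  obtain c where c: "\<forall>p\<in>Z. c p \<noteq> 0" and W_eq: "W = cycle_combination Z c"
    using W by (auto simp: torus_simps torus_potentials_def)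
  have "orbit_relation V E x `` {W} = {W' \<in> torus_potentials Z.
      \<exists>\<phi> \<in> right_equivalences (quiver V E x). act (quiver V E x) \<phi> ` torus_potentials Z = torus_potentials Z
        \<and> W' = act (quiver V E x) \<phi> (cycle_combination Z c)}"
    using W unfolding orbit_relation_def preserving_right_equivalences_def primitive_potentials_eq W_eq
    by (auto simp: torus_simps)
  also have "\<dots> = {W' \<in> torus_potentials Z.
      \<exists>t. (\<forall>e. t e \<noteq> 0) \<and> W' = cycle_combination Z (\<lambda>p. c p * (\<Prod>e\<leftarrow>p. t e))}"
    unfolding orbit_iff[OF c] ..
  also have "\<dots> = {cycle_combination Z (\<lambda>p. c p * (\<Prod>e\<leftarrow>p. t e)) | t. \<forall>e. t e \<noteq> 0}"
  proof -
    have "cycle_combination Z (\<lambda>p. c p * (\<Prod>e\<leftarrow>p. t e)) \<in> torus_potentials Z" if "\<forall>e. t e \<noteq> 0" for t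
    proof -
      have "\<forall>p\<in>Z. c p * (\<Prod>e\<leftarrow>p. t e) \<noteq> 0" using c that by (auto simp: prod_list_zero_iff)
      then show ?thesis unfolding torus_potentials_def by blast
    qed
    then show ?thesis by blast
  qed
  also have "\<dots> = {cycle_combination Z (\<lambda>p. \<Prod>e\<leftarrow>p. t e) \<otimes>\<^bsub>T\<^esub> W | t. \<forall>e. t e \<noteq> 0}"
    unfolding W_eq cycle_combination_mult by (simp add: mult.commute)
  also have "\<dots> = N #>\<^bsub>T\<^esub> W"
    unfolding N_eq r_coset_def by blast
  finally show ?thesis .
qed

lemma primitive_moduli_eq: "primitive_moduli V E x = T Mod N"
proof -
  interpret T: comm_group T by (rule torus_comm_group)
  \<comment> \<open>Both sides collect the values of one and the same assignment, from a potential
    to its orbit or coset.\<close>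
  have "torus_potentials Z // orbit_relation V E x = rcosets\<^bsub>T\<^esub> N"
    unfolding quotient_def RCOSETS_def using orbit_eq_coset by (simp add: torus_simps)
  moreover have "orbit_relation V E x `` {\<one>\<^bsub>T\<^esub>} = N"
    using orbit_eq_coset[OF T.one_closed] T.coset_mult_one subgroup.subset[OF N_subgroup] by simp
  ultimately show ?thesis
    by (simp add: primitive_moduli_def FactGroup_def primitive_potentials_eq)
qed

text \<open>The first isomorphism theorem for the map from a 2-cochain to the orbit of its
  potential. Injectivity of \<open>potential_of_cochain\<close> identifies the kernel, a priori the
  preimage of \<open>N\<close>, with the coboundaries.\<close>

lemma moduli_iso_cohomology:
  "(primitive_moduli V E x :: ('a arrow, 'k) potential set monoid) \<cong> cohomology_group 2 K kx"
proof -
  interpret T: comm_group T by (rule torus_comm_group)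
  let ?G = "cochains K kx 2"
  have normal: "N \<lhd> T" using N_subgroup by (rule T.subgroup_imp_normal)
  define h where "h = (\<lambda>f. N #>\<^bsub>T\<^esub> potential_of_cochain f)"
  have "h \<in> hom ?G (T Mod N)"
    using Group.hom_compose[OF potential_of_cochain_hom normal.r_coset_hom_Mod[OF normal]]
    by (simp add: h_def comp_def)
  then interpret h: group_hom ?G "T Mod N" h
    using cochains_group normal.factorgroup_is_group[OF normal]
    by (simp add: group_hom_def group_hom_axioms_def)
  have "kernel ?G (T Mod N) h = {f \<in> carrier ?G. potential_of_cochain f \<in> N}"
  proof -
    have "N #>\<^bsub>T\<^esub> W = N \<longleftrightarrow> W \<in> N" if "W \<in> carrier T" for W
      using that N_subgroup T.coset_join1 T.coset_join2 subgroup.subset by metis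
    then show ?thesis
      using potential_of_cochain_hom by (auto simp: kernel_def h_def hom_def)
  qed
  also have "\<dots> = B"
    using B_subset inj_potential_of_cochain by (auto simp: N_def dest: inj_onD)
  finally have kernel: "kernel ?G (T Mod N) h = B" .
  have "h ` carrier ?G = carrier (T Mod N)"
    unfolding carrier_FactGroup h_def potential_of_cochain_onto[symmetric] image_image ..
  then have "?G Mod B \<cong> T Mod N"
    using h.FactGroup_iso kernel by simp
  then have "T Mod N \<cong> ?G Mod B"
    using group.iso_sym normal.factorgroup_is_group[OF h.normal_kernel] kernel by metis
  then show ?thesis by (simp add: primitive_moduli_eq cohomology_group_2 B_def)
qed

end

theorem theorem4p7:
  fixes V :: "'a set" and E :: "('a \<times> 'a) set" and x :: "'a letter list"
  assumes graph: "simple_graph V E"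
    and word: "x \<in> free_semigroup V"
    and A: "\<forall>a \<in> V. mult_in x a \<ge> 3"
    and B: "\<forall>a b. (a, b) \<in> E \<longrightarrow> ab_cycles V E x a b \<noteq> {}"
  shows "(primitive_moduli V E x :: ('a arrow, 'k :: field_char_0) potential set monoid)
    \<cong> cohomology_group 2 (word_complex V E x) (multiplicative_group :: 'k monoid)"
proof -
  interpret word_quiver V E x "TYPE('k)" using graph A by unfold_locales
  show ?thesis by (rule moduli_iso_cohomology)
qed

end
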